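(* Let $\beta>\alpha>2$ be real numbers and let $E$ be the lowest eigenvalue of the self-adjoint operator $Q(\alpha,\beta)$ on $\mathbb{C}^2\otimes L^2(\mathbb{R})$. Put $$E_{\mathrm{upper}}=\frac{\sqrt{\alpha\beta}\,\sqrt{\alpha\beta-1}}{\alpha+\beta+|\alpha-\beta|\,\frac{(\alpha\beta-1)^{1/4}}{\sqrt{\alpha\beta}}\,\operatorname{Re}\rho},$$ where $\rho\in\mathbb{C}$ is determined by $\rho^2=\sqrt{\alpha\beta-1}-i$ and $\operatorname{Re}\rho>0$. Suppose that $$\frac12>\left(\frac12\beta-E_{\mathrm{upper}}\right)^{-2}\frac{1}{\alpha^2-1}+\frac{1}{\alpha^2-1}.$$ Then $E$ is a simple eigenvalue of $Q(\alpha,\beta)$, i.e. $\dim\operatorname{Ker}(Q(\alpha,\beta)-E)=1$.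
   Context: For $\alpha,\beta>0$ with $\alpha\beta>1$, the non-commutative harmonic oscillator is the operator $$Q(\alpha,\beta)=A\otimes\left(-\frac12\frac{d^2}{dx^2}+\frac12x^2\right)+J\otimes\left(x\frac{d}{dx}+\frac12\right),\quad A=\begin{pmatrix}\alpha&0\\0&\beta\end{pmatrix},\quad J=\begin{pmatrix}0&-1\\1&0\end{pmatrix},$$ acting in the Hilbert space $\mathbb{C}^2\otimes L^2(\mathbb{R})$. It defines a positive self-adjoint operator with purely discrete spectrum $\lambda_1\le\lambda_2\le\cdots\uparrow\infty$ (eigenvalues counted with multiplicity). $E=\lambda_1$ is the lowest eigenvalue. *)

theory Defs
  imports "HOL-Analysis.Analysis"
begin

subsection \<open>Complex vector spaces\<close>

class scaleC =
  fixes scaleC :: "complex \<Rightarrow> 'a \<Rightarrow> 'a"  (infixr "*\<^sub>C" 75)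

class complex_vector = scaleC + ab_group_add +
  assumes scaleC_add_right: "a *\<^sub>C (x + y) = a *\<^sub>C x + a *\<^sub>C y"
    and scaleC_add_left: "(a + b) *\<^sub>C x = a *\<^sub>C x + b *\<^sub>C x"
    and scaleC_scaleC: "a *\<^sub>C (b *\<^sub>C x) = (a * b) *\<^sub>C x"
    and scaleC_one: "1 *\<^sub>C x = x"

global_interpretation complex_vector:
  vector_space "scaleC :: complex \<Rightarrow> 'a::complex_vector \<Rightarrow> 'a"
  by unfold_locales (rule scaleC_add_right scaleC_add_left scaleC_scaleC scaleC_one)+

instantiation vec :: (complex_vector, finite) complex_vector
begin

definition scaleC_vec :: "complex \<Rightarrow> 'a ^ 'b \<Rightarrow> 'a ^ 'b" where
  "c *\<^sub>C u = (\<chi> i. c *\<^sub>C (u $ i))"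

instance
  by standard
    (simp_all add: scaleC_vec_def vec_eq_iff scaleC_add_right scaleC_add_left
      scaleC_scaleC scaleC_one)

end


subsection \<open>The space \<open>L\<^sup>2(\<real>)\<close>\<close>

definition square_integrable :: "(real \<Rightarrow> complex) \<Rightarrow> bool" where
  "square_integrable f \<longleftrightarrow>
     f \<in> borel_measurable lborel \<and> integrable lborel (\<lambda>x. (cmod (f x))\<^sup>2)"

lemma square_integrable_zero: "square_integrable (\<lambda>x. 0)"
  by (simp add: square_integrable_def)

lemma square_integrable_scale:
  assumes "square_integrable f"
  shows "square_integrable (\<lambda>x. c * f x)"
  using assms by (auto simp: square_integrable_def norm_mult power_mult_distrib)

lemma square_integrable_add:
  assumes "square_integrable f" "square_integrable g"
  shows "square_integrable (\<lambda>x. f x + g x)"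
proof -
  have [measurable]: "f \<in> borel_measurable lborel" "g \<in> borel_measurable lborel"
    using assms by (auto simp: square_integrable_def)
  have bound_integrable: "integrable lborel (\<lambda>x. 2 * (cmod (f x))\<^sup>2 + 2 * (cmod (g x))\<^sup>2)"
    using assms by (auto simp: square_integrable_def)
  have bound: "(cmod (f x + g x))\<^sup>2 \<le> 2 * (cmod (f x))\<^sup>2 + 2 * (cmod (g x))\<^sup>2" for x
  proof -
    have "(cmod (f x + g x))\<^sup>2 \<le> (cmod (f x) + cmod (g x))\<^sup>2"
      by (intro power_mono norm_triangle_ineq) auto
    also have "\<dots> \<le> 2 * (cmod (f x))\<^sup>2 + 2 * (cmod (g x))\<^sup>2"
      using zero_le_power2[of "cmod (f x) - cmod (g x)"]
      by (simp add: power2_sum power2_diff)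
    finally show ?thesis .
  qed
  have "integrable lborel (\<lambda>x. (cmod (f x + g x))\<^sup>2)"
  proof (rule Bochner_Integration.integrable_bound[OF bound_integrable])
    show "(\<lambda>x. (cmod (f x + g x))\<^sup>2) \<in> borel_measurable lborel"
      by measurable
    show "AE x in lborel. norm ((cmod (f x + g x))\<^sup>2) \<le>
        norm (2 * (cmod (f x))\<^sup>2 + 2 * (cmod (g x))\<^sup>2)"
      using bound by (simp add: abs_of_nonneg)
  qed
  moreover have "(\<lambda>x. f x + g x) \<in> borel_measurable lborel"
    by measurable
  ultimately show ?thesis
    by (simp add: square_integrable_def)
qed

lemma square_integrable_uminus:
  assumes "square_integrable f"
  shows "square_integrable (\<lambda>x. - f x)"
  using square_integrable_scale[OF assms, of "- 1"] by simp

lemma square_integrable_diff: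
  assumes "square_integrable f" "square_integrable g"
  shows "square_integrable (\<lambda>x. f x - g x)"
  using square_integrable_add[OF assms(1) square_integrable_uminus[OF assms(2)]] by simp

definition L2_rel :: "(real \<Rightarrow> complex) \<Rightarrow> (real \<Rightarrow> complex) \<Rightarrow> bool" where
  "L2_rel f g \<longleftrightarrow>
     square_integrable f \<and> square_integrable g \<and> (AE x in lborel. f x = g x)"

quotient_type L2 = "real \<Rightarrow> complex" / partial: L2_rel
proof (rule part_equivpI)
  show "\<exists>f. L2_rel f f"
    using square_integrable_zero by (auto simp: L2_rel_def)
  show "symp L2_rel"
    by (rule sympI) (simp add: L2_rel_def eq_commute)
  show "transp L2_rel"
  proof (rule transpI)
    fix f g h
    assume fg: "L2_rel f g" and gh: "L2_rel g h"
    then have "AE x in lborel. f x = g x" "AE x in lborel. g x = h x"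
      by (auto simp: L2_rel_def)
    then have "AE x in lborel. f x = h x"
      by eventually_elim simp
    with fg gh show "L2_rel f h"
      by (simp add: L2_rel_def)
  qed
qed

instantiation L2 :: complex_vector
begin

lift_definition zero_L2 :: L2 is "\<lambda>x. 0"
  by (simp add: L2_rel_def square_integrable_zero)

lift_definition plus_L2 :: "L2 \<Rightarrow> L2 \<Rightarrow> L2" is "\<lambda>f g x. f x + g x"
  by (auto simp: L2_rel_def square_integrable_add)

lift_definition uminus_L2 :: "L2 \<Rightarrow> L2" is "\<lambda>f x. - f x"
  by (auto simp: L2_rel_def square_integrable_uminus)

lift_definition minus_L2 :: "L2 \<Rightarrow> L2 \<Rightarrow> L2" is "\<lambda>f g x. f x - g x"
  by (auto simp: L2_rel_def square_integrable_diff)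

lift_definition scaleC_L2 :: "complex \<Rightarrow> L2 \<Rightarrow> L2" is "\<lambda>c f x. c * f x"
  by (auto simp: L2_rel_def square_integrable_scale)

instance
  by standard
    (transfer, simp add: L2_rel_def algebra_simps square_integrable_zero square_integrable_add
      square_integrable_scale square_integrable_uminus square_integrable_diff)+

end


subsection \<open>Unbounded operators\<close>

text \<open>
  An operator is given by its graph, so that its domain is \<^const>\<open>Domain\<close>.
  Sums and products carry their natural domains. The product \<open>S T\<close>
  (first \<open>T\<close>, then \<open>S\<close>) is \<open>T O S\<close>.
\<close>

type_synonym 'a operator = "('a \<times> 'a) set"

definition op_add :: "'a::complex_vector operator \<Rightarrow> 'a operator \<Rightarrow> 'a operator" where
  "op_add S T = {(u, v + w) | u v w. (u, v) \<in> S \<and> (u, w) \<in> T}"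

definition op_scale :: "complex \<Rightarrow> 'a::complex_vector operator \<Rightarrow> 'a operator" where
  "op_scale c T = {(u, c *\<^sub>C v) | u v. (u, v) \<in> T}"

definition op_ker :: "'a::complex_vector operator \<Rightarrow> 'a set" where
  "op_ker T = {u. (u, 0) \<in> T}"

text \<open>\<open>Ker (T - \<mu>)\<close>\<close>

definition eigenspace :: "'a::complex_vector operator \<Rightarrow> complex \<Rightarrow> 'a set" where
  "eigenspace T \<mu> = op_ker (op_add T (op_scale (- \<mu>) Id))"

definition is_eigenvalue :: "'a::complex_vector operator \<Rightarrow> complex \<Rightarrow> bool" where
  "is_eigenvalue T \<mu> \<longleftrightarrow> (\<exists>u \<in> eigenspace T \<mu>. u \<noteq> 0)"

text \<open>Meant for self-adjoint operators, all of whose eigenvalues are real.\<close>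

definition is_lowest_eigenvalue :: "'a::complex_vector operator \<Rightarrow> real \<Rightarrow> bool" where
  "is_lowest_eigenvalue T E \<longleftrightarrow>
     is_eigenvalue T (of_real E) \<and> (\<forall>\<mu>::real. is_eigenvalue T (of_real \<mu>) \<longrightarrow> E \<le> \<mu>)"

text \<open>
  \<open>\<complex>\<^sup>n \<otimes> L\<^sup>2(\<real>)\<close> is \<open>L2 ^ 'n\<close>, and \<open>M \<otimes> T\<close> has domain \<open>\<complex>\<^sup>n \<otimes> Domain T\<close>.
\<close>

definition op_tensor :: "complex ^ 'n ^ 'n \<Rightarrow> L2 operator \<Rightarrow> (L2 ^ 'n) operator" where
  "op_tensor M T =
     {(u, \<chi> i. \<Sum>j\<in>UNIV. (M $ i $ j) *\<^sub>C (w $ j)) | u w. \<forall>j. (u $ j, w $ j) \<in> T}"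


subsection \<open>Position and differentiation on \<open>L\<^sup>2(\<real>)\<close>\<close>

lift_definition is_mult_by_x :: "L2 \<Rightarrow> L2 \<Rightarrow> bool" is
  "\<lambda>f g. AE x in lborel. g x = complex_of_real x * f x"
proof -
  show "?thesis f f' g g'" if "L2_rel f f'" "L2_rel g g'" for f f' g g'
  proof -
    have "AE x in lborel. f x = f' x" "AE x in lborel. g x = g' x"
      using that by (auto simp: L2_rel_def)
    then have "AE x in lborel.
        (g x = complex_of_real x * f x) = (g' x = complex_of_real x * f' x)"
      by eventually_elim simp
    then show ?thesis
      by (rule eventually_cong) simp
  qed
qed

definition op_x :: "L2 operator" where
  "op_x = {(f, g). is_mult_by_x f g}"

definition test_function :: "(real \<Rightarrow> real) \<Rightarrow> bool" where
  "test_function \<phi> \<longleftrightarrow>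
     (\<forall>n x. (deriv ^^ n) \<phi> field_differentiable at x) \<and> compact (closure {x. \<phi> x \<noteq> 0})"

lemma test_function_measurable:
  assumes "test_function \<phi>"
  shows "\<phi> \<in> borel_measurable borel" "deriv \<phi> \<in> borel_measurable borel"
proof -
  have "continuous_on UNIV ((deriv ^^ n) \<phi>)" for n
    using assms
    by (auto simp: test_function_def continuous_on_eq_continuous_at
        intro: field_differentiable_imp_continuous_at)
  from this[of 0] this[of 1]
  show "\<phi> \<in> borel_measurable borel" "deriv \<phi> \<in> borel_measurable borel"
    by (auto intro: borel_measurable_continuous_onI)
qed

text \<open>Weak derivative; by linearity real-valued test functions suffice.\<close>

lift_definition is_weak_deriv :: "L2 \<Rightarrow> L2 \<Rightarrow> bool" is
  "\<lambda>f g. \<forall>\<phi>. test_function \<phi> \<longrightarrow>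
     (LINT x|lborel. f x * complex_of_real (deriv \<phi> x)) =
     - (LINT x|lborel. g x * complex_of_real (\<phi> x))"
proof -
  have cong: "(LINT x|lborel. f x * complex_of_real (\<psi> x)) =
      (LINT x|lborel. f' x * complex_of_real (\<psi> x))"
    if "L2_rel f f'" and [measurable]: "\<psi> \<in> borel_measurable borel" for f f' \<psi>
  proof -
    have [measurable]: "f \<in> borel_measurable borel" "f' \<in> borel_measurable borel"
      and ae: "AE x in lborel. f x = f' x"
      using that(1) by (auto simp: L2_rel_def square_integrable_def)
    show ?thesis
      by (rule integral_cong_AE) (use ae in auto)
  qed
  show "?thesis f f' g g'" if "L2_rel f f'" "L2_rel g g'" for f f' g g'
    using cong[OF that(1)] cong[OF that(2)] test_function_measurable by simp
qed

definition op_ddx :: "L2 operator" where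
  "op_ddx = {(f, g). is_weak_deriv f g}"


subsection \<open>The non-commutative harmonic oscillator\<close>

text \<open>\<open>-1/2 d\<^sup>2/dx\<^sup>2 + 1/2 x\<^sup>2\<close>\<close>

definition harmonic_oscillator :: "L2 operator" where
  "harmonic_oscillator =
     op_add (op_scale (- (1/2)) (op_ddx O op_ddx)) (op_scale (1/2) (op_x O op_x))"

text \<open>\<open>x d/dx + 1/2\<close>\<close>

definition dilation_generator :: "L2 operator" where
  "dilation_generator = op_add (op_ddx O op_x) (op_scale (1/2) Id)"

definition matA :: "real \<Rightarrow> real \<Rightarrow> complex ^ 2 ^ 2" where
  "matA \<alpha> \<beta> = vector [vector [of_real \<alpha>, 0], vector [0, of_real \<beta>]]"

definition matJ :: "complex ^ 2 ^ 2" where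
  "matJ = vector [vector [0, - 1], vector [1, 0]]"

text \<open>
  The domain is \<open>\<complex>\<^sup>2 \<otimes> Domain harmonic_oscillator\<close>, i.e. all \<open>u\<close> with \<open>u, u', u'', x\<^sup>2 u\<close>
  square integrable (then so is \<open>x u'\<close>). For \<open>\<alpha>, \<beta> > 0\<close> and \<open>\<alpha> \<beta> > 1\<close> the operator is
  self-adjoint on this domain.
\<close>

definition ncho :: "real \<Rightarrow> real \<Rightarrow> (L2 ^ 2) operator" where
  "ncho \<alpha> \<beta> =
     op_add (op_tensor (matA \<alpha> \<beta>) harmonic_oscillator) (op_tensor matJ dilation_generator)"

end

theory Submission
  imports Defs "HOL-Probability.Probability"
begin

text \<open>
  In the basis of Hermite functions the oscillator is a direct sum of Jacobi operators coupling
  the coefficients \<open>a\<^sub>n\<close> of the first and \<open>b\<^sub>n\<close> of the second component: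
  \<open>(a\<^sub>0, b\<^sub>2, a\<^sub>4, \<dots>)\<close>, \<open>(b\<^sub>0, a\<^sub>2, b\<^sub>4, \<dots>)\<close> and two blocks with odd indices.
  For \<open>\<alpha> > 2\<close> and energies up to \<open>\<alpha>/2\<close> the diagonal dominates off the index 0, so a
  bounded solution of the eigenvalue equation is determined by \<open>a\<^sub>0\<close> and \<open>b\<^sub>0\<close>. A fixed point
  argument gives an eigenvalue \<open>\<mu> < \<alpha>/2\<close> of the first block, hence \<open>E \<le> \<mu>\<close>, and
  comparing decaying solutions of the first two blocks shows that \<open>E\<close> is not an eigenvalue of
  the second one. So every eigenvector for \<open>E\<close> has \<open>b\<^sub>0 = 0\<close> and is determined by \<open>a\<^sub>0\<close>.
\<close>


subsection \<open>Hermite functions\<close>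

text \<open>Domains are given by weak derivatives on classes of functions, so an eigenvector is
  reached only through its Hermite coefficients. The passage is made by two one-sided statements: an
  eigenvector yields a bounded complex solution of the recursion and is zero if all its coefficients
  are, while a geometrically decaying real solution can be summed to an eigenvector. Boundedness
  suffices on the first side because diagonal dominance acts as a maximum principle in the supremum
  norm. The constants serve one final comparison. For n \<ge> 1 the diagonal is at least 2n and the
  two couplings add up to at most 5n/4. This leaves room for a decay by the factor 3 along the
  block, which bounds the entries off index 0 by 1/3. With \<delta> = \<beta> - \<alpha> > 0 and
  \<epsilon> = \<mu> - E \<ge> 0, an eigenvector in the second block would give \<delta>/2 +
  \<epsilon> \<le> 5\<delta>/12 + \<epsilon>/6. Since \<epsilon> may be 0, the strictness of
  \<alpha> < \<beta> is what makes this absurd; minimality of E gives the sign of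
  \<epsilon>.\<close>

definition hr :: "nat \<Rightarrow> real" where "hr n = sqrt (real n / 2)"

lemma hr_0 [simp]: "hr 0 = 0" by (simp add: hr_def)

lemma hr_pos: "0 < n \<Longrightarrow> 0 < hr n" by (simp add: hr_def)

lemma hr_nonneg [simp]: "0 \<le> hr n" by (simp add: hr_def)

lemma hr_sq: "hr n * hr n = real n / 2"
  by (simp add: hr_def)

lemma hr_le: "hr n \<le> real n"
proof -
  have "hr n * hr n \<le> real n * real n"
    unfolding hr_sq by (cases n) (auto simp: algebra_simps)
  then show ?thesis
    using abs_le_square_iff[of "hr n" "real n"] by (simp add: power2_eq_square)
qed

text \<open>Up to a common factor these are the \<open>L\<^sup>2\<close>-normalised Hermite functions, and
  \<open>hr\<close> contains the matrix entries of \<open>x\<close> and \<open>d/dx\<close> with respect to them.\<close>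

fun herm :: "nat \<Rightarrow> real \<Rightarrow> real" where
  "herm 0 x = exp (- (x\<^sup>2) / 2)"
| "herm (Suc 0) x = x * herm 0 x / hr 1"
| "herm (Suc (Suc n)) x = (x * herm (Suc n) x - hr (Suc n) * herm n x) / hr (Suc (Suc n))"

lemma herm_mult: "x * herm n x = hr n * herm (n - 1) x + hr (Suc n) * herm (Suc n) x"
  using hr_pos[of "Suc n"] by (cases n) (auto simp: field_simps)

text \<open>Induction along the recursion: differentiating it and applying \<open>herm_mult\<close>
  to the products with x leaves a multiple of \<open>herm (Suc n) x\<close>, whose coefficient
  vanishes because the squares of consecutive \<open>hr\<close> differ by 1/2. This is the
  commutation relation of d/dx and x in coefficient form.\<close>

lemma herm_deriv:
  "(herm n has_real_derivative hr n * herm (n - 1) x - hr (Suc n) * herm (Suc n) x) (at x)"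
proof (induction n x rule: herm.induct)
  case (1 x)
  have "herm 0 = (\<lambda>x. exp (- (x\<^sup>2) / 2))" by auto
  then show ?case
    using hr_pos[of 1] by (auto intro!: derivative_eq_intros)
next
  case (2 x)
  have eq: "herm (Suc 0) = (\<lambda>x. x * herm 0 x / hr 1)" by auto
  have "((\<lambda>x. x * herm 0 x / hr 1) has_real_derivative
      (herm 0 x + x * (- hr (Suc 0) * herm (Suc 0) x)) / hr 1) (at x)"
    by (rule DERIV_cong[OF DERIV_cdivide[OF DERIV_mult[OF DERIV_ident 2]]]) 
      (simp add: mult.commute del: herm.simps)
  then have "(herm (Suc 0) has_real_derivative
      (herm 0 x + x * (- hr (Suc 0) * herm (Suc 0) x)) / hr 1) (at x)"
    by (simp only: eq[symmetric])
  moreover have "(herm 0 x + x * (- hr (Suc 0) * herm (Suc 0) x)) / hr 1 =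
      hr (Suc 0) * herm 0 x - hr (Suc (Suc 0)) * herm (Suc (Suc 0)) x"
  proof -
    have *: "x * herm (Suc 0) x = hr (Suc 0) * herm 0 x + hr (Suc (Suc 0)) * herm (Suc (Suc 0)) x"
      using herm_mult[of x "Suc 0"] by (simp del: herm.simps)
    have "2 * (hr (Suc 0) * hr (Suc 0)) = 1" by (simp add: hr_sq)
    with * have "herm 0 x + x * (- hr (Suc 0) * herm (Suc 0) x) = 
      hr (Suc 0) * (hr (Suc 0) * herm 0 x - hr (Suc (Suc 0)) * herm (Suc (Suc 0)) x)"
      by algebra
    then show ?thesis
      using hr_pos[of "Suc 0"] by (simp del: herm.simps)
  qed
  ultimately show ?case
    by (simp del: herm.simps)
next
  case (3 n x)
  let ?a = "hr n" and ?b = "hr (Suc n)" and ?c = "hr (Suc (Suc n))" and ?d = "hr (Suc (Suc (Suc n)))"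
  have eq: "herm (Suc (Suc n)) = (\<lambda>x. (x * herm (Suc n) x - hr (Suc n) * herm n x) / hr (Suc (Suc n)))"
    by auto
  have "(herm (Suc (Suc n)) has_real_derivative
      (herm (Suc n) x + x * (?b * herm n x - ?c * herm (Suc (Suc n)) x)
        - ?b * (?a * herm (n - 1) x - ?b * herm (Suc n) x)) / ?c) (at x)"
    unfolding eq
    apply (rule derivative_eq_intros 3 refl)+
    using hr_pos[of "Suc (Suc n)"] by (simp_all add: field_simps)
  moreover have "(herm (Suc n) x + x * (?b * herm n x - ?c * herm (Suc (Suc n)) x)
        - ?b * (?a * herm (n - 1) x - ?b * herm (Suc n) x)) =
     ?c * (?c * herm (Suc n) x - ?d * herm (Suc (Suc (Suc n))) x)"
  proof -
    have m: "x * herm n x = ?a * herm (n - 1) x + ?b * herm (Suc n) x"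
       "x * herm (Suc (Suc n)) x = ?c * herm (Suc n) x + ?d * herm (Suc (Suc (Suc n))) x"
      using herm_mult[of x n] herm_mult[of x "Suc (Suc n)"] by (simp_all del: herm.simps)
    have "1 + 2 * (?b * ?b) - 2 * (?c * ?c) = 0"
      by (simp add: hr_sq field_simps)
    then have "herm (Suc n) x * (1 + 2 * (?b * ?b) - 2 * (?c * ?c)) = 0"
      by simp
    moreover have "x * (?b * herm n x - ?c * herm (Suc (Suc n)) x) = ?b * (x * herm n x) - ?c * (x * herm (Suc (Suc n)) x)"
      by (simp add: algebra_simps)
    ultimately show ?thesis
      unfolding m by algebra
  qed
  ultimately show ?case
    using hr_pos[of "Suc (Suc n)"] by (simp del: herm.simps)
qed

text \<open>The factor x in the recursion is absorbed by |x| \<le> exp |x| at the price of one unit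
  of the rate, so the induction has to run over all rates t simultaneously.\<close>

lemma herm_exp_bound: "\<exists>C. \<forall>x. \<bar>herm n x\<bar> \<le> C * exp (- t * \<bar>x\<bar>)"
proof (induction n arbitrary: t rule: induct_nat_012)
  case 0
  have "\<bar>herm 0 x\<bar> \<le> exp (t\<^sup>2 / 2) * exp (- t * \<bar>x\<bar>)" for x
  proof -
    have "0 \<le> (\<bar>x\<bar> - t)\<^sup>2" by simp
    then have "- (x\<^sup>2) / 2 \<le> t\<^sup>2 / 2 + - t * \<bar>x\<bar>"
      by (simp add: power2_diff algebra_simps)
    then show ?thesis
      by (simp flip: exp_add)
  qed
  then show ?case by blast
next
  case 1
  have "\<bar>herm 1 x\<bar> \<le> exp ((t + 1)\<^sup>2 / 2) / hr 1 * exp (- t * \<bar>x\<bar>)" for x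
  proof -
    have "0 \<le> (\<bar>x\<bar> - (t + 1))\<^sup>2" by simp
    then have "\<bar>x\<bar> + - (x\<^sup>2) / 2 \<le> (t + 1)\<^sup>2 / 2 + - t * \<bar>x\<bar>"
      by (simp add: power2_diff algebra_simps)
    then have *: "exp \<bar>x\<bar> * exp (- (x\<^sup>2) / 2) \<le> exp ((t + 1)\<^sup>2 / 2) * exp (- t * \<bar>x\<bar>)"
      by (simp flip: exp_add)
    have "\<bar>x\<bar> * exp (- (x\<^sup>2) / 2) \<le> exp \<bar>x\<bar> * exp (- (x\<^sup>2) / 2)"
      using exp_ge_add_one_self[of "\<bar>x\<bar>"] by (intro mult_right_mono) (linarith | simp)+
    from this * have "\<bar>x\<bar> * exp (- (x\<^sup>2) / 2) / hr 1 \<le> exp ((t + 1)\<^sup>2 / 2) * exp (- t * \<bar>x\<bar>) / hr 1"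
      by (intro divide_right_mono) (rule order_trans, assumption+, simp)
    then show ?thesis by (simp add: abs_mult)
  qed
  then show ?case unfolding One_nat_def by blast
next
  case (ge2 n)
  obtain C where C: "\<And>x. \<bar>herm n x\<bar> \<le> C * exp (- t * \<bar>x\<bar>)" using ge2(1)[of t] by blast
  obtain D where D: "\<And>x. \<bar>herm (Suc n) x\<bar> \<le> D * exp (- (t + 1) * \<bar>x\<bar>)" using ge2(2)[of "t+1"] by blast
  have "\<bar>herm (Suc (Suc n)) x\<bar> \<le> (D + hr (Suc n) * C) / hr (Suc (Suc n)) * exp (- t * \<bar>x\<bar>)" for x
  proof -
    have "\<bar>x\<bar> * \<bar>herm (Suc n) x\<bar> \<le> exp \<bar>x\<bar> * (D * exp (- (t + 1) * \<bar>x\<bar>))"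
      using exp_ge_add_one_self[of "\<bar>x\<bar>"] by (intro mult_mono D) (linarith | simp)+
    also have "\<dots> = D * exp (- t * \<bar>x\<bar>)"
      by (simp add: algebra_simps flip: exp_add)
    finally have 1: "\<bar>x\<bar> * \<bar>herm (Suc n) x\<bar> \<le> D * exp (- t * \<bar>x\<bar>)" .
    have 2: "hr (Suc n) * \<bar>herm n x\<bar> \<le> hr (Suc n) * (C * exp (- t * \<bar>x\<bar>))"
      by (intro mult_left_mono C) auto
    have "\<bar>x * herm (Suc n) x - hr (Suc n) * herm n x\<bar> \<le> \<bar>x * herm (Suc n) x\<bar> + \<bar>hr (Suc n) * herm n x\<bar>"
      by (rule abs_triangle_ineq4)
    also have "\<dots> \<le> D * exp (- t * \<bar>x\<bar>) + hr (Suc n) * (C * exp (- t * \<bar>x\<bar>))"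
      using 1 2 by (simp add: abs_mult)
    finally have "\<bar>x * herm (Suc n) x - hr (Suc n) * herm n x\<bar> / hr (Suc (Suc n)) \<le> 
      (D * exp (- t * \<bar>x\<bar>) + hr (Suc n) * (C * exp (- t * \<bar>x\<bar>))) / hr (Suc (Suc n))"
      by (intro divide_right_mono) auto
    then show ?thesis by (simp add: field_simps)
  qed
  then show ?case by blast
qed

declare herm.simps [simp del]

lemma herm_isCont [continuous_intros]: "isCont (herm n) x"
  using herm_deriv DERIV_isCont by blast

lemma continuous_herm: "continuous_on S (herm n)"
  by (simp add: continuous_at_imp_continuous_on herm_isCont)

lemma herm_measurable [measurable]: "herm n \<in> borel_measurable borel"
  by (intro borel_measurable_continuous_onI continuous_herm)

section \<open>Integrals of derivatives, norms and uniform bounds\<close>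

lemma integrable_inverse_1_plus_square_lborel: "integrable lborel (\<lambda>x::real. inverse (1 + x\<^sup>2))"
  using integrable_inverse_1_plus_square by (simp add: set_integrable_def)

lemma exp_abs_le: "exp (- \<bar>x::real\<bar>) \<le> 2 * inverse (1 + x\<^sup>2)"
proof -
  have "1 + x\<^sup>2 \<le> 2 * exp \<bar>x\<bar>"
    using exp_lower_Taylor_quadratic[of "\<bar>x\<bar>"] by simp
  moreover have "0 < 1 + x\<^sup>2"
    by (simp add: add_pos_nonneg)
  ultimately show ?thesis
    by (simp add: exp_minus field_simps)
qed

lemma integrable_exp_abs: "integrable lborel (\<lambda>x::real. exp (- \<bar>x\<bar>))"
proof (rule Bochner_Integration.integrable_bound)
  show "integrable lborel (\<lambda>x::real. 2 * inverse (1 + x\<^sup>2))"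
    using integrable_inverse_1_plus_square_lborel by simp
  show "AE x::real in lborel. norm (exp (- \<bar>x\<bar>)) \<le> norm (2 * inverse (1 + x\<^sup>2))"
    using exp_abs_le by (intro AE_I2) (auto intro: order_trans[OF _ abs_ge_self])
qed auto

lemma integral_derivative_eq_0:
  fixes F f :: "real \<Rightarrow> real"
  assumes "\<And>x. (F has_real_derivative f x) (at x)" "\<And>x. isCont f x" "integrable lborel f"
    and "(F \<longlongrightarrow> 0) at_bot" "(F \<longlongrightarrow> 0) at_top"
  shows "integral\<^sup>L lborel f = 0"
proof -
  have "(LBINT x=-\<infinity>..\<infinity>. f x) = 0 - 0"
    by (rule interval_integral_FTC_integrable[where F = F])
      (use assms in \<open>auto simp: has_real_derivative_iff_has_vector_derivative set_integrable_def
        ereal_tendsto_simps1\<close>)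
  then show ?thesis
    by (simp add: interval_integral_to_infinity_eq interval_lebesgue_integral_def set_lebesgue_integral_def)
qed

text \<open>The fundamental theorem on a half line; it turns an integral bound on a derivative into
  a pointwise bound, as needed for \<open>herm_sq_le\<close>.\<close>

lemma abs_le_integral_derivative:
  fixes F f :: "real \<Rightarrow> real"
  assumes "\<And>x. (F has_real_derivative f x) (at x)" "\<And>x. isCont f x" "integrable lborel f"
    and "(F \<longlongrightarrow> 0) at_bot"
  shows "\<bar>F x\<bar> \<le> (LINT x|lborel. \<bar>f x\<bar>)"
proof -
  have si: "set_integrable lborel (einterval (-\<infinity>) x) f"
    unfolding set_integrable_def using assms(3) by (intro integrable_mult_indicator) auto
  have "isCont F x" using assms(1) DERIV_isCont by blast
  then have "(F \<longlongrightarrow> F x) (at_left x)"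
    by (simp add: isCont_def filterlim_at_split)
  then have "(LBINT x=-\<infinity>..x. f x) = F x - 0"
    by (intro interval_integral_FTC_integrable[where F = F])
      (use assms si in \<open>auto simp: has_real_derivative_iff_has_vector_derivative
        ereal_tendsto_simps1\<close>)
  then have "\<bar>F x\<bar> = \<bar>LINT y|lborel. indicator (einterval (-\<infinity>) x) y * f y\<bar>"
    by (simp add: interval_lebesgue_integral_def set_lebesgue_integral_def)
  also have "\<dots> \<le> (LINT y|lborel. \<bar>indicator (einterval (-\<infinity>) x) y * f y\<bar>)"
    using integral_norm_bound[of lborel "\<lambda>y. indicator (einterval (-\<infinity>) x) y * f y"] by simp
  also have "\<dots> \<le> (LINT x|lborel. \<bar>f x\<bar>)"
    using si assms(3) by (intro integral_mono integrable_abs) (auto simp: set_integrable_def abs_mult indicator_def)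
  finally show ?thesis .
qed

lemma herm_le_exp:
  obtains C where "0 < C" "\<And>x. \<bar>herm n x\<bar> \<le> C * exp (- t * \<bar>x\<bar>)"
proof -
  obtain C where C: "\<And>x. \<bar>herm n x\<bar> \<le> C * exp (- t * \<bar>x\<bar>)"
    using herm_exp_bound[of n t] by blast
  have "C * exp (- t * \<bar>x\<bar>) \<le> (\<bar>C\<bar> + 1) * exp (- t * \<bar>x\<bar>)" for x
    by (intro mult_right_mono) auto
  then show thesis
    using order_trans[OF C] by (intro that[of "\<bar>C\<bar> + 1"]) auto
qed

lemma integrable_herm: "integrable lborel (herm n)"
proof -
  obtain C where C: "0 < C" "\<And>x. \<bar>herm n x\<bar> \<le> C * exp (- 1 * \<bar>x\<bar>)"
    using herm_le_exp[of n 1] by metis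
  show ?thesis
  proof (rule Bochner_Integration.integrable_bound)
    show "integrable lborel (\<lambda>x::real. C * exp (- \<bar>x\<bar>))"
      using integrable_exp_abs by simp
    show "AE x in lborel. norm (herm n x) \<le> norm (C * exp (- \<bar>x\<bar>))"
      using C by simp
  qed auto
qed

lemma herm_bounded: obtains C where "0 < C" "\<And>x. \<bar>herm n x\<bar> \<le> C"
  using herm_le_exp[of n 0] by simp metis

lemma integrable_herm_prod: "integrable lborel (\<lambda>x. herm m x * herm n x)"
proof -
  obtain C where C: "0 < C" "\<And>x. \<bar>herm m x\<bar> \<le> C" using herm_bounded by metis
  show ?thesis
  proof (rule Bochner_Integration.integrable_bound)
    show "integrable lborel (\<lambda>x::real. C * herm n x)"
      using integrable_herm by simp
    show "AE x in lborel. norm (herm m x * herm n x) \<le> norm (C * herm n x)"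
      using C by (intro AE_I2) (simp add: abs_mult mult_right_mono)
  qed auto
qed

lemma tendsto_0_if_le_inverse_square:
  fixes f :: "real \<Rightarrow> real"
  assumes "\<And>x. \<bar>f x\<bar> \<le> B * inverse (1 + x\<^sup>2)"
  shows "(f \<longlongrightarrow> 0) at_bot" "(f \<longlongrightarrow> 0) at_top"
proof -
  have "((\<lambda>x::real. B * inverse (1 + x\<^sup>2)) \<longlongrightarrow> 0) at_bot" "((\<lambda>x::real. B * inverse (1 + x\<^sup>2)) \<longlongrightarrow> 0) at_top"
    by (intro tendsto_mult_right_zero tendsto_inverse_0_at_top filterlim_tendsto_add_at_top[OF tendsto_const];
      real_asymp)+
  then show "(f \<longlongrightarrow> 0) at_bot" "(f \<longlongrightarrow> 0) at_top"
    using assms by - (rule Lim_null_comparison[rotated], assumption, simp)+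
qed

lemma herm_tendsto_0: "(herm n \<longlongrightarrow> 0) at_bot" "(herm n \<longlongrightarrow> 0) at_top"
proof -
  obtain C where C: "0 < C" "\<And>x. \<bar>herm n x\<bar> \<le> C * exp (- 1 * \<bar>x\<bar>)"
    using herm_le_exp[of n 1] by metis
  have "\<bar>herm n x\<bar> \<le> (C * 2) * inverse (1 + x\<^sup>2)" for x
    using order_trans[OF C(2)[of x], of "C * (2 * inverse (1 + x\<^sup>2))"] exp_abs_le[of x] C(1) by (simp add: mult.assoc)
  then show "(herm n \<longlongrightarrow> 0) at_bot" "(herm n \<longlongrightarrow> 0) at_top"
    by (rule tendsto_0_if_le_inverse_square)+
qed

text \<open>The integrand is the derivative of \<open>herm m * herm n\<close>, which vanishes at
  both ends. For suitable m and n, \<open>herm_mult\<close> turns this into norm and orthogonality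
  relations.\<close>

lemma integral_herm_prod_derivative:
  assumes "\<And>x. f x = (hr m * herm (m - 1) x - hr (Suc m) * herm (Suc m) x) * herm n x +
      (hr n * herm (n - 1) x - hr (Suc n) * herm (Suc n) x) * herm m x"
  shows "(LINT x|lborel. f x) = 0"
proof (rule integral_derivative_eq_0)
  show "((\<lambda>x. herm m x * herm n x) has_real_derivative f x) (at x)" for x
    unfolding assms by (rule DERIV_mult; rule herm_deriv)
  show "isCont f x" for x
    unfolding assms[abs_def] by (intro continuous_intros)
  show "integrable lborel f"
    unfolding assms[abs_def]
    by (simp add: left_diff_distrib mult.assoc integrable_herm_prod mult.left_commute[of _ "hr _"])
  show "((\<lambda>x. herm m x * herm n x) \<longlongrightarrow> 0) at_bot" "((\<lambda>x. herm m x * herm n x) \<longlongrightarrow> 0) at_top"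
    using tendsto_mult[OF herm_tendsto_0(1) herm_tendsto_0(1), of m n]
      tendsto_mult[OF herm_tendsto_0(2) herm_tendsto_0(2), of m n] by simp_all
qed

definition hnorm :: real where "hnorm = (LINT x|lborel. (herm 0 x)\<^sup>2)"

text \<open>In the derivative of \<open>herm n * herm (Suc n)\<close> the terms with x cancel,
  leaving \<open>2 * hr (Suc n)\<close> times the difference of the two squares. So the norms of
  neighbours agree.\<close>

lemma integral_herm_sq: "(LINT x|lborel. (herm n x)\<^sup>2) = hnorm"
proof (induction n)
  case (Suc n)
  have "(LINT x|lborel. 2 * hr (Suc n) * ((herm n x)\<^sup>2 - (herm (Suc n) x)\<^sup>2)) = 0"
  proof (rule integral_herm_prod_derivative[where m = n and n = "Suc n"])
    fix x
    show "2 * hr (Suc n) * ((herm n x)\<^sup>2 - (herm (Suc n) x)\<^sup>2) =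
      (hr n * herm (n - 1) x - hr (Suc n) * herm (Suc n) x) * herm (Suc n) x +
      (hr (Suc n) * herm (Suc n - 1) x - hr (Suc (Suc n)) * herm (Suc (Suc n)) x) * herm n x"
      using herm_mult[of x n] herm_mult[of x "Suc n"] unfolding diff_Suc_1 by algebra
  qed
  then have "(LINT x|lborel. (herm n x)\<^sup>2 - (herm (Suc n) x)\<^sup>2) = 0"
    using hr_pos[of "Suc n"] by simp
  then have "(LINT x|lborel. (herm n x)\<^sup>2) - (LINT x|lborel. (herm (Suc n) x)\<^sup>2) = 0"
    by (subst (asm) Bochner_Integration.integral_diff)
      (use integrable_herm_prod in \<open>auto simp: power2_eq_square\<close>)
  then show ?case using Suc by simp
qed (simp add: hnorm_def)

text \<open>The derivative of \<open>herm n * herm 0\<close> reduces to a multiple of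
  \<open>herm (Suc n) * herm 0\<close>. The relation serves to read the zeroth coefficient off a
  Hermite series.\<close>

lemma integral_herm_orthogonal_0: "(LINT x|lborel. herm (Suc n) x * herm 0 x) = 0"
proof -
  have "(LINT x|lborel. - 2 * hr (Suc n) * (herm (Suc n) x * herm 0 x)) = 0"
  proof (rule integral_herm_prod_derivative[where m = n and n = 0])
    fix x
    show "- 2 * hr (Suc n) * (herm (Suc n) x * herm 0 x) =
      (hr n * herm (n - 1) x - hr (Suc n) * herm (Suc n) x) * herm 0 x +
      (hr 0 * herm (0 - 1) x - hr (Suc 0) * herm (Suc 0) x) * herm n x"
      using herm_mult[of x n] herm_mult[of x 0] unfolding hr_0 by algebra
  qed
  then show ?thesis using hr_pos[of "Suc n"] by simp
qed

lemma hnorm_pos: "0 < hnorm"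
proof -
  have "hnorm = (LINT x|lborel. exp (- x\<^sup>2))"
    unfolding hnorm_def by (intro Bochner_Integration.integral_cong)
      (auto simp: herm.simps power2_eq_square simp flip: exp_add)
  moreover have "0 < (LINT x|lborel. exp (- x\<^sup>2 :: real))"
  proof -
    have i: "integrable lborel (\<lambda>x::real. exp (- x\<^sup>2))"
      using integrable_herm_prod[of 0 0] by (simp add: herm.simps flip: exp_add)
    have "(LINT x|lborel. exp (- x\<^sup>2 :: real)) \<noteq> 0"
    proof
      assume "(LINT x|lborel. exp (- x\<^sup>2 :: real)) = 0"
      then have "AE x in lborel. exp (- x\<^sup>2 :: real) = 0"
        using integral_nonneg_eq_0_iff_AE[OF i] by simp
      then show False using ae_filter_eq_bot_iff[of "lborel :: real measure"] by (simp add: eventually_False)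
    qed
    moreover have "0 \<le> (LINT x|lborel. exp (- x\<^sup>2 :: real))" by simp
    ultimately show ?thesis by linarith
  qed
  ultimately show ?thesis by simp
qed

text \<open>A one-dimensional Sobolev inequality: the square is bounded by the integral of its
  absolute derivative, hence by the squared norms of \<open>herm n\<close> and of its derivative.
  The latter grows linearly in n because \<open>hr n\<close> has square n/2.\<close>

lemma herm_sq_le: "(herm n x)\<^sup>2 \<le> 2 * hnorm * real (Suc n)"
proof -
  let ?d = "\<lambda>x. hr n * herm (n - 1) x - hr (Suc n) * herm (Suc n) x"
  let ?g = "\<lambda>x. (herm n x)\<^sup>2 + 2 * ((hr n)\<^sup>2 * (herm (n - 1) x)\<^sup>2 + (hr (Suc n))\<^sup>2 * (herm (Suc n) x)\<^sup>2)"
  have sq: "integrable lborel (\<lambda>x. (herm n x)\<^sup>2)" for n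
    using integrable_herm_prod[of n n] by (simp add: power2_eq_square)
  have i: "integrable lborel (\<lambda>x. ?d x * herm n x + ?d x * herm n x)"
    by (simp add: left_diff_distrib mult.assoc integrable_herm_prod mult.left_commute[of _ "hr _"])
  have "\<bar>herm n x * herm n x\<bar> \<le> (LINT x|lborel. \<bar>?d x * herm n x + ?d x * herm n x\<bar>)"
  proof (rule abs_le_integral_derivative[where F = "\<lambda>x. herm n x * herm n x"])
    show "((\<lambda>x. herm n x * herm n x) has_real_derivative ?d x * herm n x + ?d x * herm n x) (at x)" for x
      by (rule DERIV_mult; rule herm_deriv)
    show "isCont (\<lambda>x. ?d x * herm n x + ?d x * herm n x) x" for x
      by (intro continuous_intros)
    show "((\<lambda>x. herm n x * herm n x) \<longlongrightarrow> 0) at_bot"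
      using tendsto_mult[OF herm_tendsto_0(1) herm_tendsto_0(1), of n n] by simp
  qed (rule i)
  also have "\<dots> \<le> (LINT x|lborel. ?g x)"
  proof (rule integral_mono)
    show "integrable lborel (\<lambda>x. \<bar>?d x * herm n x + ?d x * herm n x\<bar>)"
      using i by (rule integrable_abs)
    show "integrable lborel ?g" using sq by simp
    fix x
    let ?a = "hr n * herm (n - 1) x" and ?b = "hr (Suc n) * herm (Suc n) x"
    have "\<bar>?d x * herm n x + ?d x * herm n x\<bar> = 2 * \<bar>?d x\<bar> * \<bar>herm n x\<bar>"
      by (simp add: abs_mult)
    also have "\<dots> \<le> (?d x)\<^sup>2 + (herm n x)\<^sup>2"
      using sum_squares_bound[of "\<bar>?d x\<bar>" "\<bar>herm n x\<bar>"] by simp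
    also have "(?d x)\<^sup>2 \<le> 2 * (?a\<^sup>2 + ?b\<^sup>2)"
      using zero_le_power2[of "?a + ?b"] power2_sum[of ?a ?b] power2_diff[of ?a ?b] by argo
    finally show "\<bar>?d x * herm n x + ?d x * herm n x\<bar> \<le> ?g x"
      by (simp add: power_mult_distrib)
  qed
  also have "\<dots> = hnorm + 2 * ((hr n)\<^sup>2 * hnorm + (hr (Suc n))\<^sup>2 * hnorm)"
    using sq by (simp add: integral_herm_sq)
  also have "\<dots> = 2 * hnorm * real (Suc n)"
    by (simp add: power2_eq_square[of "hr _"] hr_sq algebra_simps)
  finally show ?thesis by (simp add: power2_eq_square)
qed

text \<open>Starting from a pointwise bound linear in n, each of two multiplications by x through
  \<open>herm_mult\<close> costs one factor n + 1. The weight \<open>inverse (1 + x\<^sup>2)\<close>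
  makes Hermite series square integrable, and cubic growth in n is harmless against rapidly
  decreasing coefficients.\<close>

lemma herm_uniform_bound:
  obtains B where "0 < B" "\<And>n x. \<bar>herm n x\<bar> \<le> B * real (Suc n) ^ 3 * inverse (1 + x\<^sup>2)"
proof
  define A where "A = 1 + 2 * hnorm"
  have A: "1 \<le> A" using hnorm_pos by (simp add: A_def)
  have 1: "\<bar>herm n x\<bar> \<le> A * real (Suc n)" for n x
  proof -
    have "(herm n x)\<^sup>2 \<le> A * real (Suc n)"
      using herm_sq_le[of n x] by (simp add: A_def algebra_simps)
    also have "\<dots> \<le> (A * real (Suc n)) * (A * real (Suc n))"
      using A mult_mono[of 1 A 1 "real (Suc n)"] by (intro mult_le_cancel_right1[THEN iffD2]) auto
    finally show ?thesis
      using abs_le_square_iff[of "herm n x" "A * real (Suc n)"] A by (simp add: power2_eq_square)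
  qed
  have step: "\<bar>x\<bar> * \<bar>herm n x\<bar> \<le> 2 * real (Suc n) * M"
    if "\<bar>herm (n - 1) x\<bar> \<le> M" "\<bar>herm (Suc n) x\<bar> \<le> M" for n x M
  proof -
    have "\<bar>x\<bar> * \<bar>herm n x\<bar> = \<bar>hr n * herm (n - 1) x + hr (Suc n) * herm (Suc n) x\<bar>"
      using herm_mult[of x n] by (simp flip: abs_mult)
    also have "\<dots> \<le> hr n * \<bar>herm (n - 1) x\<bar> + hr (Suc n) * \<bar>herm (Suc n) x\<bar>"
      using abs_triangle_ineq[of "hr n * herm (n - 1) x" "hr (Suc n) * herm (Suc n) x"] by (simp add: abs_mult)
    also have "\<dots> \<le> real (Suc n) * M + real (Suc n) * M"
      using hr_le[of n] hr_le[of "Suc n"] that by (intro add_mono mult_mono) auto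
    finally show ?thesis by (simp add: algebra_simps)
  qed
  have 2: "\<bar>x\<bar> * \<bar>herm n x\<bar> \<le> 4 * A * real (Suc n) ^ 2" for n x
  proof -
    have "\<bar>x\<bar> * \<bar>herm n x\<bar> \<le> 2 * real (Suc n) * (A * (2 * real (Suc n)))"
      by (rule step; rule order_trans[OF 1], rule mult_left_mono) (use A in auto)
    then show ?thesis by (simp add: power2_eq_square algebra_simps)
  qed
  have 3: "x\<^sup>2 * \<bar>herm n x\<bar> \<le> 32 * A * real (Suc n) ^ 3" for n x
  proof -
    have "x\<^sup>2 * \<bar>herm n x\<bar> = \<bar>x\<bar> * (\<bar>x\<bar> * \<bar>herm n x\<bar>)"
      by (simp add: power2_eq_square)
    also have "\<bar>x\<bar> * \<bar>herm n x\<bar> = \<bar>hr n * herm (n - 1) x + hr (Suc n) * herm (Suc n) x\<bar>"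
      using herm_mult[of x n] by (simp flip: abs_mult)
    also have "\<bar>x\<bar> * \<dots> \<le> \<bar>x\<bar> * (hr n * \<bar>herm (n - 1) x\<bar> + hr (Suc n) * \<bar>herm (Suc n) x\<bar>)"
      using abs_triangle_ineq[of "hr n * herm (n - 1) x" "hr (Suc n) * herm (Suc n) x"]
      by (intro mult_left_mono) (auto simp add: abs_mult)
    also have "\<dots> = hr n * (\<bar>x\<bar> * \<bar>herm (n - 1) x\<bar>) + hr (Suc n) * (\<bar>x\<bar> * \<bar>herm (Suc n) x\<bar>)"
      by (simp add: algebra_simps)
    also have "\<dots> \<le> real (Suc n) * (4 * A * (2 * real (Suc n)) ^ 2) + real (Suc n) * (4 * A * (2 * real (Suc n)) ^ 2)"
      using hr_le[of n] hr_le[of "Suc n"] A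
      by (intro add_mono mult_mono order_trans[OF 2] power_mono mult_left_mono) auto
    finally show ?thesis by (simp add: power2_eq_square power3_eq_cube algebra_simps)
  qed
  show "0 < 33 * A" using A by simp
  show "\<bar>herm n x\<bar> \<le> 33 * A * real (Suc n) ^ 3 * inverse (1 + x\<^sup>2)" for n x
  proof -
    have "A * real (Suc n) ^ 1 \<le> A * real (Suc n) ^ 3"
      using A by (intro mult_left_mono power_increasing) auto
    with 1[of n x] have "(1 + x\<^sup>2) * \<bar>herm n x\<bar> \<le> 33 * A * real (Suc n) ^ 3"
      using 3[of x n] by (simp only: distrib_right power_one_right mult_1_left)
    moreover have "0 < 1 + x\<^sup>2" by (simp add: add_pos_nonneg)
    ultimately show ?thesis by (simp add: field_simps)
  qed
qed


subsection \<open>Weak derivatives against Hermite functions\<close>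

text \<open>The classical function exp(-1/x), extended by 0, with polynomials in 1/x as prefactors.
  These make the family closed under differentiation: in the variable y = 1/x the derivative
  replaces p by y^2 (p - p').\<close>

definition flat :: "real poly \<Rightarrow> real \<Rightarrow> real" where
  "flat p x = (if 0 < x then poly p (1 / x) * exp (- (1 / x)) else 0)"

lemma poly_mult_exp_minus_tendsto_0: "((\<lambda>y::real. poly p y * exp (- y)) \<longlongrightarrow> 0) at_top"
proof -
  have "((\<lambda>y::real. \<Sum>i\<le>degree p. coeff p i * (y ^ i / exp y)) \<longlongrightarrow> (\<Sum>i\<le>degree p. coeff p i * 0)) at_top"
    by (intro tendsto_sum tendsto_mult tendsto_const tendsto_power_div_exp_0)
  then show ?thesis
    by (simp add: poly_altdef exp_minus divide_inverse sum_distrib_right mult.assoc)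
qed

lemma flat_deriv: "(flat p has_real_derivative flat ([:0, 0, 1:] * (p - pderiv p)) x) (at x)"
proof -
  consider "x > 0" | "x < 0" | "x = 0" by linarith
  then show ?thesis
  proof cases
    case 1
    have "((\<lambda>x. poly p (1 / x) * exp (- (1 / x))) has_real_derivative
        flat ([:0, 0, 1:] * (p - pderiv p)) x) (at x)"
      using 1 by (auto intro!: derivative_eq_intros DERIV_chain'[OF _ poly_DERIV, of "\<lambda>x. 1 / x"]
          simp: flat_def field_simps power2_eq_square)
    then show ?thesis
      by (rule has_field_derivative_transform_within_open[where S = "{0<..}"])
        (use 1 in \<open>auto simp: flat_def\<close>)
  next
    case 2
    have "((\<lambda>x. 0) has_real_derivative flat ([:0, 0, 1:] * (p - pderiv p)) x) (at x)"
      using 2 by (simp add: flat_def)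
    then show ?thesis
      by (rule has_field_derivative_transform_within_open[where S = "{..<0}"])
        (use 2 in \<open>auto simp: flat_def\<close>)
  next
    case 3
    have "((\<lambda>h. (flat p (0 + h) - flat p 0) / h) \<longlongrightarrow> 0) (at_right 0)"
    proof -
      \<comment> \<open>Dividing by h multiplies the polynomial by y = 1/h, and exp(-y) still
        dominates.\<close>
      have "((\<lambda>h. poly ([:0, 1:] * p) (inverse h) * exp (- inverse h)) \<longlongrightarrow> 0) (at_right (0::real))"
        by (rule filterlim_compose[OF poly_mult_exp_minus_tendsto_0 filterlim_inverse_at_top_right])
      then show ?thesis
        by (rule Lim_transform_eventually)
          (auto simp: eventually_at_filter flat_def field_simps)
    qed
    moreover have "((\<lambda>h. (flat p (0 + h) - flat p 0) / h) \<longlongrightarrow> 0) (at_left 0)"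
      by (rule Lim_transform_eventually[OF tendsto_const])
        (auto simp: eventually_at_filter flat_def)
    ultimately show ?thesis
      using 3 by (simp add: DERIV_def filterlim_at_split flat_def)
  qed
qed

text \<open>An algebra of functions closed under differentiation, containing compactly supported
  functions; this is how membership in \<^const>\<open>test_function\<close> is established.\<close>

inductive_set smooth_alg :: "(real \<Rightarrow> real) set" where
  const: "(\<lambda>x. c) \<in> smooth_alg"
| herm: "herm n \<in> smooth_alg"
| flat: "(\<lambda>x. flat p (a * x + b)) \<in> smooth_alg"
| add: "f \<in> smooth_alg \<Longrightarrow> g \<in> smooth_alg \<Longrightarrow> (\<lambda>x. f x + g x) \<in> smooth_alg"
| mult: "f \<in> smooth_alg \<Longrightarrow> g \<in> smooth_alg \<Longrightarrow> (\<lambda>x. f x * g x) \<in> smooth_alg"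

lemma smooth_alg_deriv_ex:
  "f \<in> smooth_alg \<Longrightarrow> \<exists>f'\<in>smooth_alg. \<forall>x. (f has_real_derivative f' x) (at x)"
proof (induction rule: smooth_alg.induct)
  case (const c)
  show ?case by (rule bexI[OF _ smooth_alg.const[of 0]]) simp
next
  case (herm n)
  have "(\<lambda>x. hr n * herm (n - 1) x + (- hr (Suc n)) * herm (Suc n) x) \<in> smooth_alg"
    by (intro smooth_alg.intros)
  then show ?case
    using herm_deriv[of n] by (intro bexI) auto
next
  case (flat p a b)
  have "((\<lambda>x. flat p (a * x + b)) has_real_derivative
      flat ([:0, 0, 1:] * (p - pderiv p)) (a * x + b) * a) (at x)" for x
    by (rule DERIV_chain2[OF flat_deriv]) (auto intro!: derivative_eq_intros)
  then show ?case
    by (intro bexI[of _ "\<lambda>x. flat ([:0, 0, 1:] * (p - pderiv p)) (a * x + b) * a"])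
      (auto intro!: smooth_alg.intros)
next
  case (add f g)
  then obtain f' g' where "f' \<in> smooth_alg" "\<forall>x. (f has_real_derivative f' x) (at x)"
    "g' \<in> smooth_alg" "\<forall>x. (g has_real_derivative g' x) (at x)" by blast
  then show ?case
    by (intro bexI[of _ "\<lambda>x. f' x + g' x"]) (auto intro!: smooth_alg.add derivative_intros)
next
  case (mult f g)
  then obtain f' g' where "f' \<in> smooth_alg" "\<forall>x. (f has_real_derivative f' x) (at x)"
    "g' \<in> smooth_alg" "\<forall>x. (g has_real_derivative g' x) (at x)" by blast
  then show ?case
    using mult.hyps by (intro bexI[of _ "\<lambda>x. f' x * g x + g' x * f x"])
     (auto intro!: smooth_alg.add smooth_alg.mult DERIV_mult)
qed

lemma smooth_alg_deriv:
  assumes "f \<in> smooth_alg"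
  shows "deriv f \<in> smooth_alg" "(f has_real_derivative deriv f x) (at x)"
proof -
  obtain f' where f': "f' \<in> smooth_alg" "\<And>x. (f has_real_derivative f' x) (at x)"
    using smooth_alg_deriv_ex[OF assms] by blast
  then have "deriv f = f'"
    by (auto intro: DERIV_imp_deriv)
  with f' show "deriv f \<in> smooth_alg" "(f has_real_derivative deriv f x) (at x)" by simp_all
qed

lemma smooth_alg_isCont: "f \<in> smooth_alg \<Longrightarrow> isCont f x"
  using smooth_alg_deriv(2) DERIV_isCont by blast

lemma smooth_alg_test_function:
  assumes "f \<in> smooth_alg" "\<And>x. r < \<bar>x\<bar> \<Longrightarrow> f x = 0"
  shows "test_function f"
  unfolding test_function_def
proof (intro conjI allI)
  fix n x
  have "(deriv ^^ n) f \<in> smooth_alg"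
    using assms(1) by (induction n) (auto intro: smooth_alg_deriv)
  then show "(deriv ^^ n) f field_differentiable at x"
    using smooth_alg_deriv(2) field_differentiable_def by blast
next
  have "\<bar>x\<bar> \<le> r" if "f x \<noteq> 0" for x
    using assms(2)[of x] that by fastforce
  then have "{x. f x \<noteq> 0} \<subseteq> {-r..r}"
    by (force simp: abs_le_iff)
  then have "bounded {x. f x \<noteq> 0}"
    using bounded_closed_interval bounded_subset by blast
  then show "compact (closure {x. f x \<noteq> 0})"
    by (simp add: compact_closure)
qed

text \<open>The product lives on (-1, 1), where both arguments are positive, and
  \<open>exp 2\<close> normalises the value at 0 to 1. The affine arguments carry explicit
  coefficients to match the rule \<open>smooth_alg.flat\<close>.\<close>

definition bump :: "real \<Rightarrow> real" where
  "bump x = exp 2 * (flat 1 (1 * x + 1) * flat 1 ((- 1) * x + 1))"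

lemma bump_smooth: "bump \<in> smooth_alg"
  unfolding bump_def[abs_def] by (intro smooth_alg.intros)

lemma bump_scale_smooth: "(\<lambda>x. bump (c * x)) \<in> smooth_alg"
proof -
  have "(\<lambda>x. exp 2 * (flat 1 (c * x + 1) * flat 1 ((- c) * x + 1))) \<in> smooth_alg"
    by (intro smooth_alg.intros)
  then show ?thesis by (simp add: bump_def)
qed

lemma bump_0: "bump 0 = 1"
  by (simp add: bump_def flat_def flip: exp_add)

lemma bump_eq_0: "1 \<le> \<bar>x\<bar> \<Longrightarrow> bump x = 0"
  by (auto simp: bump_def flat_def)

lemma smooth_alg_bounded:
  assumes "f \<in> smooth_alg" "\<And>x. 1 < \<bar>x\<bar> \<Longrightarrow> f x = 0"
  obtains M where "0 \<le> M" "\<And>x. \<bar>f x\<bar> \<le> M"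
proof -
  have "compact (f ` {-1..1})"
    by (intro compact_continuous_image continuous_at_imp_continuous_on ballI smooth_alg_isCont assms) auto
  then obtain M where M: "\<And>x. x \<in> {-1..1} \<Longrightarrow> \<bar>f x\<bar> \<le> M"
    using compact_imp_bounded[of "f ` {-1..1}"] unfolding bounded_iff by (metis imageI real_norm_def)
  have "\<bar>f x\<bar> \<le> max 0 M" for x
    using M[of x] assms(2)[of x] by (cases "1 < \<bar>x\<bar>") (auto simp: abs_le_iff not_less le_max_iff_disj)
  then show thesis by (intro that[of "max 0 M"]) auto
qed

lemma deriv_bump_eq_0:
  assumes "1 < \<bar>x\<bar>"
  shows "deriv bump x = 0"
proof -
  have "((\<lambda>x. 0) has_real_derivative 0) (at x)" by simp
  then have "(bump has_real_derivative 0) (at x)"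
    by (rule has_field_derivative_transform_within_open[where S = "{x. 1 < \<bar>x\<bar>}"])
      (use assms in \<open>auto simp: bump_eq_0 intro!: open_Collect_less continuous_intros\<close>)
  then show ?thesis by (rule DERIV_imp_deriv)
qed

lemma square_integrable_times_integrable:
  assumes "square_integrable f" "h \<in> borel_measurable borel" "integrable lborel (\<lambda>x. (h x)\<^sup>2)"
  shows "integrable lborel (\<lambda>x. f x * complex_of_real (h x))"
proof -
  have [measurable]: "f \<in> borel_measurable borel" "h \<in> borel_measurable borel"
    using assms by (auto simp: square_integrable_def)
  show ?thesis
  proof (rule Bochner_Integration.integrable_bound)
    show "integrable lborel (\<lambda>x. (cmod (f x))\<^sup>2 + (h x)\<^sup>2)"
      using assms by (auto simp: square_integrable_def)
    have "cmod (f x) * \<bar>h x\<bar> \<le> (cmod (f x))\<^sup>2 + (h x)\<^sup>2" for x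
    proof -
      have "2 * (cmod (f x) * \<bar>h x\<bar>) \<le> (cmod (f x))\<^sup>2 + (h x)\<^sup>2"
        using sum_squares_bound[of "cmod (f x)" "\<bar>h x\<bar>"] by (simp add: mult.assoc)
      moreover have "0 \<le> cmod (f x) * \<bar>h x\<bar>" by simp
      ultimately show ?thesis by linarith
    qed
    then show "AE x in lborel. norm (f x * complex_of_real (h x)) \<le> norm ((cmod (f x))\<^sup>2 + (h x)\<^sup>2)"
      by (simp add: norm_mult)
  qed measurable
qed

lemma square_integrable_times_herm:
  "square_integrable f \<Longrightarrow> integrable lborel (\<lambda>x. f x * complex_of_real (herm n x))"
  using integrable_herm_prod[of n n]
  by (intro square_integrable_times_integrable) (auto simp: power2_eq_square)

lemma square_integrable_measurable [measurable_dest]: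
  "square_integrable f \<Longrightarrow> f \<in> borel_measurable borel"
  by (simp add: square_integrable_def)

text \<open>The test functions \<open>x \<mapsto> bump (x / m) * herm n x\<close> approximate the Hermite functions.\<close>

lemma weak_derivative_herm:
  assumes f: "square_integrable f" and g: "square_integrable g"
    and weak: "\<And>\<phi>. test_function \<phi> \<Longrightarrow>
     (LINT x|lborel. f x * complex_of_real (deriv \<phi> x)) =
     - (LINT x|lborel. g x * complex_of_real (\<phi> x))"
  shows "(LINT x|lborel. g x * complex_of_real (herm n x)) =
     complex_of_real (hr (Suc n)) * (LINT x|lborel. f x * complex_of_real (herm (Suc n) x)) -
     complex_of_real (hr n) * (LINT x|lborel. f x * complex_of_real (herm (n - 1) x))"
proof -
  note [measurable] = square_integrable_measurable[OF f] square_integrable_measurable[OF g]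
  define d where "d x = hr n * herm (n - 1) x - hr (Suc n) * herm (Suc n) x" for x
  define c where "c m = inverse (real (Suc m))" for m
  have c: "c \<longlonglongrightarrow> 0" "\<And>m. 0 < c m" "\<And>m. c m \<le> 1"
    unfolding c_def by (rule LIMSEQ_inverse_real_of_nat, simp, simp add: field_simps)
  define \<phi> where "\<phi> m x = bump (c m * x) * herm n x" for m x
  obtain M0 where M0: "0 \<le> M0" "\<And>x. \<bar>bump x\<bar> \<le> M0"
    using smooth_alg_bounded[OF bump_smooth] bump_eq_0 by (metis less_imp_le)
  obtain M1 where M1: "0 \<le> M1" "\<And>x. \<bar>deriv bump x\<bar> \<le> M1"
    using smooth_alg_bounded[OF smooth_alg_deriv(1)[OF bump_smooth]] deriv_bump_eq_0 by metis
  have \<phi>_smooth: "\<phi> m \<in> smooth_alg" for m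
    unfolding \<phi>_def[abs_def] by (intro smooth_alg.mult bump_scale_smooth smooth_alg.herm)
  have test: "test_function (\<phi> m)" for m
  proof (rule smooth_alg_test_function[OF \<phi>_smooth])
    show "\<phi> m x = 0" if "real (Suc m) < \<bar>x\<bar>" for x
      using that by (auto simp: \<phi>_def c_def abs_mult field_simps intro!: bump_eq_0)
  qed
  have deriv_\<phi>: "deriv (\<phi> m) x = (deriv bump (c m * x) * c m) * herm n x + d x * bump (c m * x)" for m x
  proof (rule DERIV_imp_deriv)
    have "((\<lambda>x. bump (c m * x)) has_real_derivative deriv bump (c m * x) * c m) (at x)"
      by (rule DERIV_chain2[OF smooth_alg_deriv(2)[OF bump_smooth]]) (auto intro!: derivative_eq_intros)
    then show "(\<phi> m has_real_derivative (deriv bump (c m * x) * c m) * herm n x + d x * bump (c m * x)) (at x)"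
      unfolding \<phi>_def[abs_def] d_def by (rule DERIV_mult) (rule herm_deriv)
  qed
  have [measurable]: "\<phi> m \<in> borel_measurable borel" "deriv (\<phi> m) \<in> borel_measurable borel" for m
    using test_function_measurable[OF test[of m]] by auto
  have [measurable]: "d \<in> borel_measurable borel" unfolding d_def[abs_def] by measurable
  have int_g: "integrable lborel (\<lambda>x. g x * complex_of_real (herm n x))"
    by (rule square_integrable_times_herm[OF g])
  have int_f: "integrable lborel (\<lambda>x. f x * complex_of_real (herm k x))" for k
    by (rule square_integrable_times_herm[OF f])
  have fd: "f x * complex_of_real (d x) = complex_of_real (hr n) * (f x * complex_of_real (herm (n - 1) x)) -
      complex_of_real (hr (Suc n)) * (f x * complex_of_real (herm (Suc n) x))" for x
    by (simp add: d_def algebra_simps)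
  have int_d: "integrable lborel (\<lambda>x. f x * complex_of_real (d x))"
    unfolding fd by (intro Bochner_Integration.integrable_diff integrable_mult_right int_f)
  have lim_c: "(\<lambda>m. c m * x) \<longlonglongrightarrow> 0" for x
    using tendsto_mult[OF c(1) tendsto_const[of x]] by simp
  have lim_bump: "(\<lambda>m. bump (c m * x)) \<longlonglongrightarrow> 1" for x
    using isCont_tendsto_compose[OF smooth_alg_isCont[OF bump_smooth] lim_c[of x]] bump_0 by simp
  \<comment> \<open>The cutoff is stretched by the factor 1 / \<open>c m\<close>, so its derivative
    carries the factor \<open>c m\<close> and the corresponding term of the product rule disappears
    in the limit.\<close>
  have lim_dbump: "(\<lambda>m. deriv bump (c m * x) * c m) \<longlonglongrightarrow> 0" for x
    using tendsto_mult[OF isCont_tendsto_compose[OF smooth_alg_isCont[OF smooth_alg_deriv(1)[OF bump_smooth]] lim_c[of x]] c(1)]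
    by simp
  have limg: "(\<lambda>m. LINT x|lborel. g x * complex_of_real (\<phi> m x)) \<longlonglongrightarrow> (LINT x|lborel. g x * complex_of_real (herm n x))"
  proof (rule integral_dominated_convergence)
    show "integrable lborel (\<lambda>x. M0 * norm (g x * complex_of_real (herm n x)))"
      using int_g by (intro integrable_mult_right integrable_norm)
    show "AE x in lborel. (\<lambda>m. g x * complex_of_real (\<phi> m x)) \<longlonglongrightarrow> g x * complex_of_real (herm n x)"
    proof (intro AE_I2 tendsto_mult tendsto_const tendsto_of_real)
      show "(\<lambda>m. \<phi> m x) \<longlonglongrightarrow> herm n x" for x
        using tendsto_mult[OF lim_bump[of x] tendsto_const[of "herm n x"]] by (simp add: \<phi>_def)
    qed
    show "AE x in lborel. norm (g x * complex_of_real (\<phi> m x)) \<le> M0 * norm (g x * complex_of_real (herm n x))" for m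
    proof (intro AE_I2)
      fix x
      have "cmod (g x) * (\<bar>bump (c m * x)\<bar> * \<bar>herm n x\<bar>) \<le> cmod (g x) * (M0 * \<bar>herm n x\<bar>)"
        by (intro mult_left_mono mult_right_mono M0) auto
      then show "norm (g x * complex_of_real (\<phi> m x)) \<le> M0 * norm (g x * complex_of_real (herm n x))"
        by (simp add: \<phi>_def norm_mult abs_mult mult_ac)
    qed
  qed measurable
  have limf: "(\<lambda>m. LINT x|lborel. f x * complex_of_real (deriv (\<phi> m) x)) \<longlonglongrightarrow> (LINT x|lborel. f x * complex_of_real (d x))"
  proof (rule integral_dominated_convergence)
    show "integrable lborel (\<lambda>x. M1 * norm (f x * complex_of_real (herm n x)) + M0 * norm (f x * complex_of_real (d x)))"
      using int_f int_d by (intro Bochner_Integration.integrable_add integrable_mult_right integrable_norm)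
    show "AE x in lborel. (\<lambda>m. f x * complex_of_real (deriv (\<phi> m) x)) \<longlonglongrightarrow> f x * complex_of_real (d x)"
    proof (intro AE_I2 tendsto_mult tendsto_const tendsto_of_real)
      show "(\<lambda>m. deriv (\<phi> m) x) \<longlonglongrightarrow> d x" for x
        using tendsto_add[OF tendsto_mult[OF lim_dbump[of x] tendsto_const[of "herm n x"]]
          tendsto_mult[OF tendsto_const[of "d x"] lim_bump[of x]]] by (simp add: deriv_\<phi>)
    qed
    show "AE x in lborel. norm (f x * complex_of_real (deriv (\<phi> m) x)) \<le>
        M1 * norm (f x * complex_of_real (herm n x)) + M0 * norm (f x * complex_of_real (d x))" for m
    proof (intro AE_I2)
      fix x
      have "\<bar>deriv (\<phi> m) x\<bar> \<le> \<bar>(deriv bump (c m * x) * c m) * herm n x\<bar> + \<bar>d x * bump (c m * x)\<bar>"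
        unfolding deriv_\<phi> by (rule abs_triangle_ineq)
      also have "\<dots> = (\<bar>deriv bump (c m * x)\<bar> * \<bar>c m\<bar>) * \<bar>herm n x\<bar> + \<bar>d x\<bar> * \<bar>bump (c m * x)\<bar>"
        by (simp add: abs_mult)
      also have "\<dots> \<le> (M1 * 1) * \<bar>herm n x\<bar> + \<bar>d x\<bar> * M0"
        using c(2)[of m] c(3)[of m] M0 M1 by (intro add_mono mult_mono) auto
      finally have "cmod (f x) * \<bar>deriv (\<phi> m) x\<bar> \<le> cmod (f x) * ((M1 * 1) * \<bar>herm n x\<bar> + \<bar>d x\<bar> * M0)"
        by (intro mult_left_mono) auto
      then show "norm (f x * complex_of_real (deriv (\<phi> m) x)) \<le>
        M1 * norm (f x * complex_of_real (herm n x)) + M0 * norm (f x * complex_of_real (d x))"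
        by (simp add: norm_mult algebra_simps)
    qed
  qed measurable
  have "(\<lambda>m. LINT x|lborel. f x * complex_of_real (deriv (\<phi> m) x)) \<longlonglongrightarrow>
      - (LINT x|lborel. g x * complex_of_real (herm n x))"
    using tendsto_minus[OF limg] by (simp only: weak[OF test])
  then have "(LINT x|lborel. f x * complex_of_real (d x)) = - (LINT x|lborel. g x * complex_of_real (herm n x))"
    by (rule LIMSEQ_unique[OF limf])
  moreover have "(LINT x|lborel. f x * complex_of_real (d x)) =
     complex_of_real (hr n) * (LINT x|lborel. f x * complex_of_real (herm (n - 1) x)) -
     complex_of_real (hr (Suc n)) * (LINT x|lborel. f x * complex_of_real (herm (Suc n) x))"
    unfolding fd using int_f by (subst Bochner_Integration.integral_diff) auto
  ultimately show ?thesis by (simp add: algebra_simps)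
qed


subsection \<open>Completeness of the Hermite functions\<close>

text \<open>Fourier uniqueness is borrowed from probability. The positive and negative parts of g
  have the same Fourier transform, hence the same mass m (its value at 0); divided by m they are
  densities of two distributions with equal characteristic functions, which coincide by Levy's
  theorem.\<close>

lemma fourier_transform_eq_0_imp_AE_eq_0:
  fixes g :: "real \<Rightarrow> real"
  assumes g: "integrable lborel g"
    and fourier: "\<And>t. (LINT x|lborel. complex_of_real (g x) * iexp (t * x)) = 0"
  shows "AE x in lborel. g x = 0"
proof -
  note [measurable] = borel_measurable_integrable[OF g]
  have fourier_p: "complex_integrable lborel (\<lambda>x. complex_of_real (h x) * iexp (t * x))"
    if "integrable lborel h" for h :: "real \<Rightarrow> real" and t
  proof (rule Bochner_Integration.integrable_bound[OF that])
    have [measurable]: "h \<in> borel_measurable borel" using borel_measurable_integrable[OF that] by simp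
    show "(\<lambda>x. complex_of_real (h x) * iexp (t * x)) \<in> borel_measurable lborel" by measurable
  qed (simp add: norm_mult)
  define p where "p x = max 0 (g x)" for x
  define q where "q x = max 0 (- g x)" for x
  have [measurable]: "p \<in> borel_measurable borel" "q \<in> borel_measurable borel"
    unfolding p_def[abs_def] q_def[abs_def] by measurable
  have ip: "integrable lborel p" and iq: "integrable lborel q"
    unfolding p_def[abs_def] q_def[abs_def] using g by auto
  have g_eq: "g x = p x - q x" for x by (simp add: p_def q_def max_def)
  have nonneg: "0 \<le> p x" "0 \<le> q x" for x by (simp_all add: p_def q_def)
  have pq: "(LINT x|lborel. complex_of_real (p x) * iexp (t * x)) = (LINT x|lborel. complex_of_real (q x) * iexp (t * x))" for t
  proof -
    have "(LINT x|lborel. complex_of_real (p x) * iexp (t * x) - complex_of_real (q x) * iexp (t * x)) = 0"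
      using fourier[of t] by (simp add: g_eq left_diff_distrib)
    then show ?thesis
      using fourier_p[OF ip, of t] fourier_p[OF iq, of t] by (subst (asm) Bochner_Integration.integral_diff) auto
  qed
  define m where "m = (LINT x|lborel. p x)"
  have mq: "m = (LINT x|lborel. q x)"
    using pq[of 0] by (simp add: m_def)
  show ?thesis
  \<comment> \<open>A zero mass cannot be normalised; both parts then vanish almost
    everywhere.\<close>
  proof (cases "m = 0")
    case True
    then have "AE x in lborel. p x = 0" "AE x in lborel. q x = 0"
      using integral_nonneg_eq_0_iff_AE[OF ip] integral_nonneg_eq_0_iff_AE[OF iq] nonneg mq
      by (auto simp: m_def)
    then show ?thesis by eventually_elim (simp add: g_eq)
  next
    case False
    have "0 \<le> m" unfolding m_def using nonneg by simp
    with False have m: "0 < m" by simp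
    define M where "M h = density lborel (\<lambda>x. ennreal (h x / m))" for h :: "real \<Rightarrow> real"
    have dist: "real_distribution (M h)" and char: "char (M h) t = (LINT x|lborel. complex_of_real (h x) * iexp (t * x)) / m"
      if h: "integrable lborel h" "\<And>x. 0 \<le> h x" "(LINT x|lborel. h x) = m" for h t
    proof -
      have [measurable]: "h \<in> borel_measurable borel" using borel_measurable_integrable[OF h(1)] by simp
      have "(\<integral>\<^sup>+x. ennreal (h x / m) \<partial>lborel) = ennreal (LINT x|lborel. h x / m)"
        using h m by (intro nn_integral_eq_integral) auto
      then have "prob_space (M h)"
        using m h by (intro prob_spaceI) (simp add: M_def emeasure_density)
      then show "real_distribution (M h)"
        by (simp add: real_distribution_def real_distribution_axioms_def M_def)
      have "char (M h) t = (LINT x|lborel. (h x / m) *\<^sub>R iexp (t * x))"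
        unfolding char_def M_def by (rule integral_density) (use h m in auto)
      also have "\<dots> = (LINT x|lborel. (complex_of_real (h x) * iexp (t * x)) / m)"
        by (simp add: scaleR_conv_of_real)
      finally show "char (M h) t = (LINT x|lborel. complex_of_real (h x) * iexp (t * x)) / m"
        by simp
    qed
    have "M p = M q"
    proof (rule Levy_uniqueness)
      show "char (M p) = char (M q)"
        using char[OF ip nonneg(1) m_def[symmetric]] char[OF iq nonneg(2) mq[symmetric]] pq by auto
    qed (auto intro!: dist ip iq nonneg simp: m_def mq[symmetric])
    then have "AE x in lborel. ennreal (p x / m) = ennreal (q x / m)"
      unfolding M_def by (intro sigma_finite_measure.density_unique[OF sigma_finite_lborel]) auto
    then show ?thesis
      by eventually_elim (use m nonneg in \<open>simp add: g_eq ennreal_inj\<close>)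
  qed
qed

text \<open>Multiplication by x maps each \<open>herm n\<close> to a combination of its neighbours,
  so orthogonality to all of them survives every power of x. Integrability is carried along to split
  the integral.\<close>

lemma herm_moments_eq_0:
  assumes f: "square_integrable f"
    and "\<And>n. (LINT x|lborel. f x * complex_of_real (herm n x)) = 0"
  shows "integrable lborel (\<lambda>x. f x * complex_of_real (x ^ k * herm n x)) \<and>
    (LINT x|lborel. f x * complex_of_real (x ^ k * herm n x)) = 0"
proof (induction k arbitrary: n)
  case 0
  then show ?case using square_integrable_times_herm[OF f] assms(2) by simp
next
  case (Suc k)
  have *: "f x * complex_of_real (x ^ Suc k * herm n x) =
    complex_of_real (hr n) * (f x * complex_of_real (x ^ k * herm (n - 1) x)) +
    complex_of_real (hr (Suc n)) * (f x * complex_of_real (x ^ k * herm (Suc n) x))" for x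
  proof -
    have "x ^ Suc k * herm n x = x ^ k * (x * herm n x)" by simp
    then show ?thesis unfolding herm_mult by (simp add: algebra_simps)
  qed
  show ?case
    unfolding * using Suc[of "n - 1"] Suc[of "Suc n"] by simp
qed

text \<open>The partial sums of the exponential series integrate to 0 by the vanishing moments. They
  are dominated by |f| times \<open>herm 0\<close> times exp(|t| |x|), which is integrable because
  \<open>herm 0\<close> decays at the rate |t| + 1.\<close>

lemma fourier_herm_0_eq_0:
  assumes f: "square_integrable f"
    and orth: "\<And>n. (LINT x|lborel. f x * complex_of_real (herm n x)) = 0"
  shows "(LINT x|lborel. f x * complex_of_real (herm 0 x) * iexp (t * x)) = 0"
proof -
  note [measurable] = square_integrable_measurable[OF f]
  define S where "S N x = f x * complex_of_real (herm 0 x) * (\<Sum>k<N. (\<i> * complex_of_real (t * x)) ^ k /\<^sub>R fact k)" for N x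
  have eq: "S N x = (\<Sum>k<N. ((\<i> * complex_of_real t) ^ k / fact k) * (f x * complex_of_real (x ^ k * herm 0 x)))" for N x
    unfolding S_def sum_distrib_left
    by (intro sum.cong) (auto simp: scaleR_conv_of_real power_mult_distrib divide_inverse)
  have "(LINT x|lborel. S N x) = 0" for N
    unfolding eq using herm_moments_eq_0[OF f orth] by (subst Bochner_Integration.integral_sum) auto
  moreover have "(\<lambda>N. LINT x|lborel. S N x) \<longlonglongrightarrow> (LINT x|lborel. f x * complex_of_real (herm 0 x) * iexp (t * x))"
  proof (rule integral_dominated_convergence)
    let ?h = "\<lambda>x. herm 0 x * exp (\<bar>t\<bar> * \<bar>x\<bar>)"
    show "integrable lborel (\<lambda>x. norm (f x * complex_of_real (?h x)))"
    proof (intro integrable_norm square_integrable_times_integrable[OF f])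
      obtain C where C: "0 < C" "\<And>x. \<bar>herm 0 x\<bar> \<le> C * exp (- (\<bar>t\<bar> + 1) * \<bar>x\<bar>)"
        using herm_le_exp[of 0 "\<bar>t\<bar> + 1"] by metis
      show "integrable lborel (\<lambda>x. (?h x)\<^sup>2)"
      proof (rule Bochner_Integration.integrable_bound)
        show "integrable lborel (\<lambda>x::real. C\<^sup>2 * exp (- \<bar>x\<bar>))"
          using integrable_exp_abs by simp
        have "(?h x)\<^sup>2 \<le> C\<^sup>2 * exp (- \<bar>x\<bar>)" for x
        proof -
          have "\<bar>?h x\<bar> \<le> C * exp (- (\<bar>t\<bar> + 1) * \<bar>x\<bar>) * exp (\<bar>t\<bar> * \<bar>x\<bar>)"
            unfolding abs_mult abs_exp_cancel by (intro mult_right_mono C) auto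
          also have "\<dots> = C * exp (- \<bar>x\<bar>)"
            by (simp add: algebra_simps flip: exp_add)
          finally have "\<bar>?h x\<bar>\<^sup>2 \<le> (C * exp (- \<bar>x\<bar>))\<^sup>2"
            by (intro power_mono) auto
          also have "\<dots> \<le> C\<^sup>2 * exp (- \<bar>x\<bar>)"
            unfolding power_mult_distrib power2_eq_square[of "exp _"] by (intro mult_left_mono mult_left_le) auto
          finally show ?thesis by simp
        qed
        then show "AE x in lborel. norm ((?h x)\<^sup>2) \<le> norm (C\<^sup>2 * exp (- \<bar>x\<bar>))"
          by (simp add: abs_mult)
      qed measurable
    qed measurable
    show "AE x in lborel. (\<lambda>N. S N x) \<longlonglongrightarrow> f x * complex_of_real (herm 0 x) * iexp (t * x)"
      unfolding S_def by (intro AE_I2 tendsto_mult tendsto_const) (use exp_converges sums_def in blast)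
    show "AE x in lborel. norm (S N x) \<le> norm (f x * complex_of_real (?h x))" for N
    proof (intro AE_I2)
      fix x
      have "cmod (\<Sum>k<N. (\<i> * complex_of_real (t * x)) ^ k /\<^sub>R fact k) \<le> (\<Sum>k<N. (\<bar>t\<bar> * \<bar>x\<bar>) ^ k /\<^sub>R fact k)"
        by (rule order_trans[OF norm_sum]) (simp add: norm_mult norm_power abs_mult divide_inverse mult.commute)
      also have "\<dots> \<le> exp (\<bar>t\<bar> * \<bar>x\<bar>)"
        using sum_le_suminf[OF summable_exp_generic, of "{..<N}" "\<bar>t\<bar> * \<bar>x\<bar>"] by (simp add: exp_def)
      finally have "cmod (f x * complex_of_real (herm 0 x)) * cmod (\<Sum>k<N. (\<i> * complex_of_real (t * x)) ^ k /\<^sub>R fact k) \<le>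
          cmod (f x * complex_of_real (herm 0 x)) * exp (\<bar>t\<bar> * \<bar>x\<bar>)"
        by (intro mult_left_mono) auto
      then show "norm (S N x) \<le> norm (f x * complex_of_real (?h x))"
        by (simp add: S_def norm_mult mult.assoc)
    qed
    show "S N \<in> borel_measurable lborel" for N
      unfolding S_def[abs_def] by measurable
  qed measurable
  ultimately show ?thesis
    by (simp add: LIMSEQ_const_iff)
qed

text \<open>The product with the Gaussian \<open>herm 0\<close> is integrable and has zero Fourier
  transform, and the Gaussian has no zeros.\<close>

lemma herm_complete_real:
  fixes g :: "real \<Rightarrow> real"
  assumes g: "square_integrable (\<lambda>x. complex_of_real (g x))"
    and orth: "\<And>n. (LINT x|lborel. complex_of_real (g x) * complex_of_real (herm n x)) = 0"
  shows "AE x in lborel. g x = 0"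
proof -
  have "AE x in lborel. g x * herm 0 x = 0"
  proof (rule fourier_transform_eq_0_imp_AE_eq_0)
    have "integrable lborel (\<lambda>x. complex_of_real (g x * herm 0 x))"
      using square_integrable_times_herm[OF g, of 0] by simp
    then show "integrable lborel (\<lambda>x. g x * herm 0 x)"
      by (simp only: complex_of_real_integrable_eq)
    show "(LINT x|lborel. complex_of_real (g x * herm 0 x) * iexp (t * x)) = 0" for t
      using fourier_herm_0_eq_0[OF g orth, of t] by simp
  qed
  then show ?thesis
    by eventually_elim (simp add: herm.simps)
qed

lemma herm_complete:
  assumes f: "square_integrable f"
    and orth: "\<And>n. (LINT x|lborel. f x * complex_of_real (herm n x)) = 0"
  shows "AE x in lborel. f x = 0"
proof -
  note [measurable] = square_integrable_measurable[OF f]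
  have int: "integrable lborel (\<lambda>x. f x * complex_of_real (herm n x))" for n
    by (rule square_integrable_times_herm[OF f])
  have si: "square_integrable (\<lambda>x. complex_of_real (h (f x)))"
    if "\<And>z. \<bar>h z\<bar> \<le> cmod z" and [measurable]: "h \<in> borel_measurable borel" for h :: "complex \<Rightarrow> real"
  proof -
    have "integrable lborel (\<lambda>x. (cmod (complex_of_real (h (f x))))\<^sup>2)"
    proof (rule Bochner_Integration.integrable_bound)
      show "integrable lborel (\<lambda>x. (cmod (f x))\<^sup>2)" using f by (simp add: square_integrable_def)
      show "AE x in lborel. norm ((cmod (complex_of_real (h (f x))))\<^sup>2) \<le> norm ((cmod (f x))\<^sup>2)"
        using power_mono[OF that(1) abs_ge_zero, where n = 2] by simp
    qed measurable
    then show ?thesis by (simp add: square_integrable_def)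
  qed
  have "AE x in lborel. Re (f x) = 0"
  proof (rule herm_complete_real)
    show "(LINT x|lborel. complex_of_real (Re (f x)) * complex_of_real (herm n x)) = 0" for n
      using integral_Re[OF int[of n]] orth[of n] by (simp flip: of_real_mult)
  qed (auto intro!: si abs_Re_le_cmod)
  moreover have "AE x in lborel. Im (f x) = 0"
  proof (rule herm_complete_real)
    show "(LINT x|lborel. complex_of_real (Im (f x)) * complex_of_real (herm n x)) = 0" for n
      using integral_Im[OF int[of n]] orth[of n] by (simp flip: of_real_mult)
  qed (auto intro!: si abs_Im_le_cmod)
  ultimately show ?thesis
    by eventually_elim (simp add: complex_eq_iff)
qed


subsection \<open>Hermite series and coefficients\<close>

text \<open>The action of \<open>x\<close> and \<open>d/dx\<close> on coefficient sequences; at \<open>n = 0\<close> the truncated index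
  \<open>n - 1\<close> is harmless because \<open>hr 0 = 0\<close>.\<close>

definition xop :: "(nat \<Rightarrow> 'a::real_vector) \<Rightarrow> nat \<Rightarrow> 'a" where
  "xop c n = hr n *\<^sub>R c (n - 1) + hr (Suc n) *\<^sub>R c (Suc n)"

definition dop :: "(nat \<Rightarrow> 'a::real_vector) \<Rightarrow> nat \<Rightarrow> 'a" where
  "dop c n = hr (Suc n) *\<^sub>R c (Suc n) - hr n *\<^sub>R c (n - 1)"

text \<open>The two squares have the same entries at distance 2, which cancel; the diagonal entries
  have opposite signs and add up to twice the sum of the squares of \<open>hr n\<close> and
  \<open>hr (Suc n)\<close>.\<close>

lemma harmonic_seq: "xop (xop c) n - dop (dop c) n = (2 * real n + 1) *\<^sub>R c n"
proof -
  let ?A = "hr n * hr n" and ?B = "hr (Suc n) * hr (Suc n)"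
  have "(?A + ?A + ?B + ?B) *\<^sub>R c n = ?A *\<^sub>R c n + ?A *\<^sub>R c n + ?B *\<^sub>R c n + ?B *\<^sub>R c n"
    by (simp only: scaleR_add_left)
  then have "xop (xop c) n - dop (dop c) n = (?A + ?A + ?B + ?B) *\<^sub>R c n"
    by (cases n) (simp_all only: xop_def dop_def, simp_all add: algebra_simps)
  moreover have "?A + ?A + ?B + ?B = 2 * real n + 1"
    by (simp add: hr_sq)
  ultimately show ?thesis by simp
qed

text \<open>The summand 1/2 cancels the diagonal of \<open>xop (dop c)\<close>, so only indices at
  distance exactly 2 are coupled. This is why the recursion splits into blocks.\<close>

lemma dilation_seq:
  "xop (dop c) n + (1/2) *\<^sub>R c n =
    (hr (Suc n) * hr (Suc (Suc n))) *\<^sub>R c (Suc (Suc n)) - (hr n * hr (n - 1)) *\<^sub>R c (n - 2)"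
proof -
  have "xop (dop c) n = (hr (Suc n) * hr (Suc (Suc n))) *\<^sub>R c (Suc (Suc n)) - (hr n * hr (n - 1)) *\<^sub>R c (n - 2)
      + (hr n * hr n - hr (Suc n) * hr (Suc n)) *\<^sub>R c n"
    by (cases n) (simp_all add: xop_def dop_def algebra_simps numeral_2_eq_2)
  moreover have "hr n * hr n - hr (Suc n) * hr (Suc n) = - (1/2)"
    by (simp add: hr_sq field_simps)
  ultimately show ?thesis by simp
qed

text \<open>Sequence counterpart of the Schwartz class. Summability with every polynomial weight
  makes it stable under \<open>xop\<close> and \<open>dop\<close> and absorbs the growth in n of the
  bounds for \<open>herm n\<close>.\<close>

definition rapid :: "(nat \<Rightarrow> real) \<Rightarrow> bool" where
  "rapid c \<longleftrightarrow> (\<forall>k. summable (\<lambda>n. real (Suc n) ^ k * \<bar>c n\<bar>))"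

lemma rapid_add: "rapid c \<Longrightarrow> rapid d \<Longrightarrow> rapid (\<lambda>n. c n + d n)"
  unfolding rapid_def
proof (intro allI)
  fix k
  assume "\<forall>k. summable (\<lambda>n. real (Suc n) ^ k * \<bar>c n\<bar>)" "\<forall>k. summable (\<lambda>n. real (Suc n) ^ k * \<bar>d n\<bar>)"
  then have "summable (\<lambda>n. real (Suc n) ^ k * \<bar>c n\<bar> + real (Suc n) ^ k * \<bar>d n\<bar>)"
    by (intro summable_add) auto
  then show "summable (\<lambda>n. real (Suc n) ^ k * \<bar>c n + d n\<bar>)"
    by (rule summable_comparison_test')
      (simp add: abs_mult mult_left_mono flip: distrib_left)
qed

lemma rapid_scale: "rapid c \<Longrightarrow> rapid (\<lambda>n. r * c n)"
  unfolding rapid_def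
proof (intro allI)
  fix k
  assume "\<forall>k. summable (\<lambda>n. real (Suc n) ^ k * \<bar>c n\<bar>)"
  then have "summable (\<lambda>n. \<bar>r\<bar> * (real (Suc n) ^ k * \<bar>c n\<bar>))"
    by (intro summable_mult) auto
  then show "summable (\<lambda>n. real (Suc n) ^ k * \<bar>r * c n\<bar>)"
    by (simp add: abs_mult mult_ac)
qed

lemma rapid_down: "rapid c \<Longrightarrow> rapid (\<lambda>n. hr (Suc n) * c (Suc n))"
  unfolding rapid_def
proof (intro allI)
  fix k
  assume "\<forall>k. summable (\<lambda>n. real (Suc n) ^ k * \<bar>c n\<bar>)"
  then have "summable (\<lambda>n. real (Suc (Suc n)) ^ Suc k * \<bar>c (Suc n)\<bar>)"
    using summable_Suc_iff[of "\<lambda>n. real (Suc n) ^ Suc k * \<bar>c n\<bar>"] by blast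
  then show "summable (\<lambda>n. real (Suc n) ^ k * \<bar>hr (Suc n) * c (Suc n)\<bar>)"
  proof (rule summable_comparison_test')
    fix n
    have "real (Suc n) ^ k * (hr (Suc n) * \<bar>c (Suc n)\<bar>) \<le> real (Suc (Suc n)) ^ k * (real (Suc (Suc n)) * \<bar>c (Suc n)\<bar>)"
      using hr_le[of "Suc n"] by (intro mult_mono power_mono) auto
    then show "norm (real (Suc n) ^ k * \<bar>hr (Suc n) * c (Suc n)\<bar>) \<le> real (Suc (Suc n)) ^ Suc k * \<bar>c (Suc n)\<bar>"
      by (simp add: abs_mult mult_ac)
  qed
qed

lemma rapid_up: "rapid c \<Longrightarrow> rapid (\<lambda>n. hr n * c (n - 1))"
  unfolding rapid_def
proof (intro allI)
  fix k
  assume "\<forall>k. summable (\<lambda>n. real (Suc n) ^ k * \<bar>c n\<bar>)"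
  then have "summable (\<lambda>n. 2 ^ k * (real (Suc n) ^ Suc k * \<bar>c n\<bar>))"
    by (intro summable_mult) blast
  then have "summable (\<lambda>n. real (Suc (Suc n)) ^ k * \<bar>hr (Suc n) * c (Suc n - 1)\<bar>)"
  proof (rule summable_comparison_test')
    fix n
    have "real (Suc (Suc n)) ^ k \<le> 2 ^ k * real (Suc n) ^ k"
      unfolding power_mult_distrib[symmetric] by (intro power_mono) auto
    then have "real (Suc (Suc n)) ^ k * (hr (Suc n) * \<bar>c n\<bar>) \<le> (2 ^ k * real (Suc n) ^ k) * (real (Suc n) * \<bar>c n\<bar>)"
      using hr_le[of "Suc n"] by (intro mult_mono) auto
    then show "norm (real (Suc (Suc n)) ^ k * \<bar>hr (Suc n) * c (Suc n - 1)\<bar>) \<le> 2 ^ k * (real (Suc n) ^ Suc k * \<bar>c n\<bar>)"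
      by (simp add: abs_mult mult_ac)
  qed
  then show "summable (\<lambda>n. real (Suc n) ^ k * \<bar>hr n * c (n - 1)\<bar>)"
    by (rule summable_Suc_iff[of "\<lambda>n. real (Suc n) ^ k * \<bar>hr n * c (n - 1)\<bar>", THEN iffD1])
qed

lemma rapid_xop: "rapid c \<Longrightarrow> rapid (xop c)"
  unfolding xop_def[abs_def] real_scaleR_def by (intro rapid_add rapid_up rapid_down)

lemma rapid_dop: "rapid c \<Longrightarrow> rapid (dop c)"
  using rapid_add[OF rapid_down rapid_scale[OF rapid_up, of _ "-1"], of c c]
  by (simp add: dop_def[abs_def])

lemma rapid_if_geometric:
  assumes "0 \<le> q" "q < 1" "\<And>n. \<bar>c n\<bar> \<le> C * q ^ n"
  shows "rapid c"
  unfolding rapid_def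
proof
  fix k
  obtain r where r: "q < r" "r < 1" using assms(2) dense by blast
  obtain s where s: "r < s" "s < 1" using r(2) dense by blast
  have "summable (\<lambda>n. real (Suc n) ^ k * r ^ n)"
  proof -
    let ?f = "\<lambda>n. real (Suc n) ^ k * r ^ n"
    have "(\<lambda>n. real (Suc (Suc n)) / real (Suc n)) \<longlonglongrightarrow> 1"
      using LIMSEQ_Suc[OF LIMSEQ_Suc_n_over_n] .
    then have "(\<lambda>n. (real (Suc (Suc n)) / real (Suc n)) ^ k * r) \<longlonglongrightarrow> 1 ^ k * r"
      by (intro tendsto_intros)
    then have "\<forall>\<^sub>F n in sequentially. (real (Suc (Suc n)) / real (Suc n)) ^ k * r < s"
      using s(1) by (intro order_tendstoD(2)) auto
    then obtain N where N: "\<And>n. N \<le> n \<Longrightarrow> (real (Suc (Suc n)) / real (Suc n)) ^ k * r < s"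
      unfolding eventually_sequentially by blast
    show ?thesis
    proof (rule summable_ratio_test[OF s(2)])
      fix n assume "N \<le> n"
      have "0 \<le> r" using r assms(1) by simp
      have "?f (Suc n) = ((real (Suc (Suc n)) / real (Suc n)) ^ k * r) * ?f n"
        by (simp add: power_divide)
      also have "\<dots> \<le> s * ?f n"
        using N[OF \<open>N \<le> n\<close>] \<open>0 \<le> r\<close> by (intro mult_right_mono) auto
      finally show "norm (?f (Suc n)) \<le> s * norm (?f n)"
        using \<open>0 \<le> r\<close> by (simp add: abs_mult)
    qed
  qed
  then have "summable (\<lambda>n. C * (real (Suc n) ^ k * r ^ n))" by (rule summable_mult)
  then show "summable (\<lambda>n. real (Suc n) ^ k * \<bar>c n\<bar>)"
  proof (rule summable_comparison_test')
    fix n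
    have "0 \<le> C" using assms(3)[of 0] by simp
    then have "C * q ^ n \<le> C * r ^ n"
      using r assms by (intro mult_left_mono power_mono) auto
    then have "real (Suc n) ^ k * \<bar>c n\<bar> \<le> real (Suc n) ^ k * (C * r ^ n)"
      using assms(3)[of n] by (intro mult_left_mono) auto
    then show "norm (real (Suc n) ^ k * \<bar>c n\<bar>) \<le> C * (real (Suc n) ^ k * r ^ n)"
      by (simp add: abs_mult mult_ac)
  qed
qed

section \<open>Hermite series with rapidly decreasing coefficients\<close>

definition hser :: "(nat \<Rightarrow> real) \<Rightarrow> real \<Rightarrow> real" where
  "hser c x = (\<Sum>n. c n * herm n x)"

lemma hser_abs_summable:
  assumes "rapid c"
  shows "summable (\<lambda>n. \<bar>c n * herm n x\<bar>)" "summable (\<lambda>n. c n * herm n x)"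
    and "\<exists>B\<ge>0. \<forall>x. \<bar>hser c x\<bar> \<le> B * inverse (1 + x\<^sup>2)"
proof -
  obtain B where B: "0 < B" "\<And>n x. \<bar>herm n x\<bar> \<le> B * real (Suc n) ^ 3 * inverse (1 + x\<^sup>2)"
    using herm_uniform_bound by metis
  define M where "M = (\<Sum>n. real (Suc n) ^ 3 * \<bar>c n\<bar>)"
  have s: "summable (\<lambda>n. real (Suc n) ^ 3 * \<bar>c n\<bar>)" using assms by (simp only: rapid_def)
  have s': "summable (\<lambda>n. (B * inverse (1 + x\<^sup>2)) * (real (Suc n) ^ 3 * \<bar>c n\<bar>))" for x
    using s by (rule summable_mult)
  have le: "\<bar>c n * herm n x\<bar> \<le> (B * inverse (1 + x\<^sup>2)) * (real (Suc n) ^ 3 * \<bar>c n\<bar>)" for n x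
  proof -
    have "\<bar>c n\<bar> * \<bar>herm n x\<bar> \<le> \<bar>c n\<bar> * (B * real (Suc n) ^ 3 * inverse (1 + x\<^sup>2))"
      by (intro mult_left_mono B) auto
    then show ?thesis by (simp add: abs_mult mult_ac)
  qed
  show a: "summable (\<lambda>n. \<bar>c n * herm n x\<bar>)" for x
    using le by (intro summable_comparison_test'[OF s'[of x]]) simp
  then show "summable (\<lambda>n. c n * herm n x)" for x by (rule summable_rabs_cancel)
  have "\<bar>hser c x\<bar> \<le> (B * M) * inverse (1 + x\<^sup>2)" for x
  proof -
    have "\<bar>hser c x\<bar> \<le> (\<Sum>n. \<bar>c n * herm n x\<bar>)"
      unfolding hser_def by (rule summable_rabs[OF a])
    also have "\<dots> \<le> (\<Sum>n. (B * inverse (1 + x\<^sup>2)) * (real (Suc n) ^ 3 * \<bar>c n\<bar>))"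
      by (rule suminf_le[OF le a s'])
    also have "\<dots> = (B * M) * inverse (1 + x\<^sup>2)"
      by (subst suminf_mult[OF s]) (simp add: M_def mult_ac)
    finally show ?thesis .
  qed
  moreover have "0 \<le> M" unfolding M_def by (rule suminf_nonneg[OF s]) simp
  ultimately show "\<exists>B\<ge>0. \<forall>x. \<bar>hser c x\<bar> \<le> B * inverse (1 + x\<^sup>2)"
    using B(1) by (intro exI[of _ "B * M"]) auto
qed

lemma hser_add: "rapid c \<Longrightarrow> rapid d \<Longrightarrow> hser (\<lambda>n. c n + d n) x = hser c x + hser d x"
  unfolding hser_def by (simp add: distrib_right suminf_add hser_abs_summable)

lemma hser_scale: "rapid c \<Longrightarrow> hser (\<lambda>n. r * c n) x = r * hser c x"
  unfolding hser_def by (simp add: mult.assoc suminf_mult hser_abs_summable)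

text \<open>Together with \<open>hser_raise\<close> this moves the index shift from the functions to
  the coefficients; multiplication by x is the sum of the two shifts and d/dx their difference. The
  term at n = 0 drops out because \<open>hr 0 = 0\<close>.\<close>

lemma hser_lower:
  assumes "rapid c"
  shows "(\<lambda>n. c n * (hr n * herm (n - 1) x)) sums hser (\<lambda>n. hr (Suc n) * c (Suc n)) x"
proof -
  have "(\<lambda>n. (hr (Suc n) * c (Suc n)) * herm n x) sums hser (\<lambda>n. hr (Suc n) * c (Suc n)) x"
    unfolding hser_def by (intro summable_sums hser_abs_summable rapid_down assms)
  then have "(\<lambda>n. c (Suc n) * (hr (Suc n) * herm (Suc n - 1) x)) sums hser (\<lambda>n. hr (Suc n) * c (Suc n)) x"
    by (simp add: mult_ac)
  then show ?thesis by (subst (asm) sums_Suc_iff) simp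
qed

lemma hser_raise:
  assumes "rapid c"
  shows "(\<lambda>n. c n * (hr (Suc n) * herm (Suc n) x)) sums hser (\<lambda>n. hr n * c (n - 1)) x"
proof -
  have "(\<lambda>n. (hr n * c (n - 1)) * herm n x) sums hser (\<lambda>n. hr n * c (n - 1)) x"
    unfolding hser_def by (intro summable_sums hser_abs_summable rapid_up assms)
  then have "(\<lambda>n. (hr (Suc n) * c (Suc n - 1)) * herm (Suc n) x) sums hser (\<lambda>n. hr n * c (n - 1)) x"
    by (subst sums_Suc_iff) simp
  then show ?thesis by (simp add: mult_ac)
qed

lemma hser_xop:
  assumes "rapid c"
  shows "x * hser c x = hser (xop c) x"
proof -
  have "(\<lambda>n. c n * (hr n * herm (n - 1) x) + c n * (hr (Suc n) * herm (Suc n) x)) sums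
    (hser (\<lambda>n. hr (Suc n) * c (Suc n)) x + hser (\<lambda>n. hr n * c (n - 1)) x)"
    by (intro sums_add hser_lower hser_raise assms)
  also have "(\<lambda>n. c n * (hr n * herm (n - 1) x) + c n * (hr (Suc n) * herm (Suc n) x)) = (\<lambda>n. x * (c n * herm n x))"
    using herm_mult[of x] by (simp add: fun_eq_iff mult.left_commute[of x] flip: distrib_left)
  finally have "(\<lambda>n. x * (c n * herm n x)) sums
    (hser (\<lambda>n. hr (Suc n) * c (Suc n)) x + hser (\<lambda>n. hr n * c (n - 1)) x)" .
  moreover have "(\<lambda>n. x * (c n * herm n x)) sums (x * hser c x)"
    unfolding hser_def by (intro sums_mult summable_sums hser_abs_summable assms)
  ultimately have "x * hser c x = hser (\<lambda>n. hr (Suc n) * c (Suc n)) x + hser (\<lambda>n. hr n * c (n - 1)) x"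
    by (rule sums_unique2[THEN sym])
  moreover have "hser (xop c) x = hser (\<lambda>n. hr n * c (n - 1)) x + hser (\<lambda>n. hr (Suc n) * c (Suc n)) x"
    unfolding xop_def[abs_def] real_scaleR_def
    by (rule hser_add[OF rapid_up[OF assms] rapid_down[OF assms]])
  ultimately show ?thesis by simp
qed

lemma hser_deriv:
  assumes c: "rapid c"
  shows "(hser c has_real_derivative hser (dop c) x) (at x)"
proof -
  let ?f' = "\<lambda>n x. c n * (hr n * herm (n - 1) x - hr (Suc n) * herm (Suc n) x)"
  obtain B where B: "0 < B" "\<And>n x. \<bar>herm n x\<bar> \<le> B * real (Suc n) ^ 3 * inverse (1 + x\<^sup>2)"
    using herm_uniform_bound by metis
  have B': "\<bar>herm n x\<bar> \<le> B * real (Suc n) ^ 3" for n x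
  proof -
    have "inverse (1 + x\<^sup>2) \<le> 1" by (simp add: inverse_le_1_iff)
    then have "B * real (Suc n) ^ 3 * inverse (1 + x\<^sup>2) \<le> B * real (Suc n) ^ 3 * 1"
      using B(1) by (intro mult_left_mono) auto
    with B(2)[of n x] show ?thesis by simp
  qed
  \<comment> \<open>Here 9 = 1 + 2^3: the raised function has n + 2 \<le> 2 (n + 1) in its cubic
    bound.\<close>
  have bound: "norm (?f' n x) \<le> (9 * B) * (real (Suc n) ^ 4 * \<bar>c n\<bar>)" for n x
  proof -
    define X where "X = real (Suc n)"
    have "hr n * \<bar>herm (n - 1) x\<bar> \<le> X * (B * X ^ 3)"
      using hr_le[of n] B(1) unfolding X_def
      by (intro mult_mono order_trans[OF B'] mult_left_mono power_mono) auto
    moreover have "hr (Suc n) * \<bar>herm (Suc n) x\<bar> \<le> X * (B * (2 * X) ^ 3)"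
      using hr_le[of "Suc n"] B(1) unfolding X_def
      by (intro mult_mono order_trans[OF B'] mult_left_mono power_mono) auto
    moreover have "X * (B * X ^ 3) + X * (B * (2 * X) ^ 3) = 9 * B * X ^ 4"
      by (simp add: power_mult_distrib power4_eq_xxxx power3_eq_cube algebra_simps)
    ultimately have "hr n * \<bar>herm (n - 1) x\<bar> + hr (Suc n) * \<bar>herm (Suc n) x\<bar> \<le> 9 * B * real (Suc n) ^ 4"
      unfolding X_def by linarith
    moreover have "\<bar>hr n * herm (n - 1) x - hr (Suc n) * herm (Suc n) x\<bar> \<le> hr n * \<bar>herm (n - 1) x\<bar> + hr (Suc n) * \<bar>herm (Suc n) x\<bar>"
      using abs_triangle_ineq4[of "hr n * herm (n - 1) x" "hr (Suc n) * herm (Suc n) x"] by (simp add: abs_mult)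
    ultimately have "\<bar>c n\<bar> * \<bar>hr n * herm (n - 1) x - hr (Suc n) * herm (Suc n) x\<bar> \<le> \<bar>c n\<bar> * (9 * B * real (Suc n) ^ 4)"
      by (intro mult_left_mono) auto
    then show ?thesis by (simp add: abs_mult mult_ac)
  qed
  have "summable (\<lambda>n. (9 * B) * (real (Suc n) ^ 4 * \<bar>c n\<bar>))"
    using c unfolding rapid_def by (intro summable_mult) blast
  then have "uniformly_convergent_on UNIV (\<lambda>n x. \<Sum>i<n. ?f' i x)"
    by (rule Weierstrass_m_test'[OF bound])
  then have deriv: "((\<lambda>x. \<Sum>n. c n * herm n x) has_field_derivative (\<Sum>n. ?f' n x)) (at x)"
    by (rule has_field_derivative_series'(2)[OF convex_UNIV _ _ UNIV_I[of 0], rotated 1])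
      (auto intro!: DERIV_cmult herm_deriv[unfolded One_nat_def] hser_abs_summable c)
  have "(\<lambda>n. c n * (hr n * herm (n - 1) x) - c n * (hr (Suc n) * herm (Suc n) x)) sums
    (hser (\<lambda>n. hr (Suc n) * c (Suc n)) x - hser (\<lambda>n. hr n * c (n - 1)) x)"
    by (intro sums_diff hser_lower hser_raise c)
  then have "(\<Sum>n. ?f' n x) = hser (\<lambda>n. hr (Suc n) * c (Suc n)) x - hser (\<lambda>n. hr n * c (n - 1)) x"
    unfolding right_diff_distrib by (rule sums_unique[symmetric])
  also have "\<dots> = hser (dop c) x"
    using hser_add[OF rapid_down[OF c] rapid_scale[OF rapid_up[OF c]], of "-1" x]
    by (subst (asm) hser_scale[OF rapid_up[OF c], of "-1" x]) (simp add: dop_def[abs_def])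
  finally have eq: "(\<Sum>n. ?f' n x) = hser (dop c) x" .
  have "hser c = (\<lambda>x. \<Sum>n. c n * herm n x)"
    by (rule ext) (rule hser_def)
  then show ?thesis
    using deriv by (simp only: eq)
qed

lemma hser_isCont: "rapid c \<Longrightarrow> isCont (hser c) x"
  using hser_deriv DERIV_isCont by blast

lemma hser_measurable: "rapid c \<Longrightarrow> hser c \<in> borel_measurable borel"
  by (intro borel_measurable_continuous_onI continuous_at_imp_continuous_on ballI hser_isCont)

lemma hser_square_integrable:
  assumes "rapid c"
  shows "square_integrable (\<lambda>x. complex_of_real (hser c x))"
proof -
  note [measurable] = hser_measurable[OF assms]
  obtain B where B: "0 \<le> B" "\<And>x. \<bar>hser c x\<bar> \<le> B * inverse (1 + x\<^sup>2)"
    using hser_abs_summable(3)[OF assms] by blast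
  have "integrable lborel (\<lambda>x. (hser c x)\<^sup>2)"
  proof (rule Bochner_Integration.integrable_bound)
    show "integrable lborel (\<lambda>x::real. B\<^sup>2 * inverse (1 + x\<^sup>2))"
      using integrable_inverse_1_plus_square_lborel by simp
    have "(hser c x)\<^sup>2 \<le> B\<^sup>2 * inverse (1 + x\<^sup>2)" for x
    proof -
      have "\<bar>hser c x\<bar>\<^sup>2 \<le> (B * inverse (1 + x\<^sup>2))\<^sup>2"
        by (intro power_mono B) auto
      also have "\<dots> \<le> B\<^sup>2 * inverse (1 + x\<^sup>2)"
        unfolding power_mult_distrib power2_eq_square[of "inverse _"]
        by (intro mult_left_mono mult_left_le) (auto simp: inverse_le_1_iff)
      finally show ?thesis by simp
    qed
    then show "AE x in lborel. norm ((hser c x)\<^sup>2) \<le> norm (B\<^sup>2 * inverse (1 + x\<^sup>2))"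
      by (intro AE_I2) (auto intro: order_trans[OF _ abs_ge_self])
  qed measurable
  then show ?thesis by (simp add: square_integrable_def)
qed

text \<open>Absolute summability allows exchanging sum and integral, and orthogonality to
  \<open>herm 0\<close> leaves a single term. It later shows that the constructed eigenvector is not
  zero.\<close>

lemma hser_integral_herm_0:
  assumes "rapid c"
  shows "(LINT x|lborel. hser c x * herm 0 x) = c 0 * hnorm"
proof -
  have s: "summable (\<lambda>n. real (Suc n) ^ 3 * \<bar>c n\<bar>)" using assms by (simp only: rapid_def)
  obtain B where B: "0 < B" "\<And>n x. \<bar>herm n x\<bar> \<le> B * real (Suc n) ^ 3 * inverse (1 + x\<^sup>2)"
    using herm_uniform_bound by metis
  have int: "integrable lborel (\<lambda>x. c n * herm n x * herm 0 x)" for n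
    using integrable_herm_prod[of n 0] by (simp add: mult.assoc)
  have "(\<lambda>n. LINT x|lborel. c n * herm n x * herm 0 x) sums (LINT x|lborel. (\<Sum>n. c n * herm n x * herm 0 x))"
  proof (rule sums_integral[OF int])
    show "AE x in lborel. summable (\<lambda>n. norm (c n * herm n x * herm 0 x))"
      using hser_abs_summable(1)[OF assms] by (auto simp: abs_mult intro!: summable_mult2)
    have "(LINT x|lborel. norm (c n * herm n x * herm 0 x)) \<le> (B * (LINT x|lborel. \<bar>herm 0 x\<bar>)) * (real (Suc n) ^ 3 * \<bar>c n\<bar>)" for n
    proof -
      have "(LINT x|lborel. norm (c n * herm n x * herm 0 x)) \<le> (LINT x|lborel. (\<bar>c n\<bar> * (B * real (Suc n) ^ 3)) * \<bar>herm 0 x\<bar>)"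
      proof (rule integral_mono)
        show "integrable lborel (\<lambda>x. norm (c n * herm n x * herm 0 x))"
          using int by (rule integrable_norm)
        show "integrable lborel (\<lambda>x. (\<bar>c n\<bar> * (B * real (Suc n) ^ 3)) * \<bar>herm 0 x\<bar>)"
          using integrable_herm[of 0] by simp
        fix x
        have "B * real (Suc n) ^ 3 * inverse (1 + x\<^sup>2) \<le> B * real (Suc n) ^ 3 * 1"
          using B(1) by (intro mult_left_mono) (auto simp: inverse_le_1_iff)
        with B(2)[of n x] have "\<bar>herm n x\<bar> \<le> B * real (Suc n) ^ 3" by simp
        then have "\<bar>c n\<bar> * \<bar>herm n x\<bar> * \<bar>herm 0 x\<bar> \<le> (\<bar>c n\<bar> * (B * real (Suc n) ^ 3)) * \<bar>herm 0 x\<bar>"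
          by (intro mult_mono) auto
        then show "norm (c n * herm n x * herm 0 x) \<le> (\<bar>c n\<bar> * (B * real (Suc n) ^ 3)) * \<bar>herm 0 x\<bar>"
          by (simp add: abs_mult)
      qed
      then show ?thesis by (simp add: mult_ac)
    qed
    then show "summable (\<lambda>n. LINT x|lborel. norm (c n * herm n x * herm 0 x))"
      by (intro summable_comparison_test'[OF summable_mult[OF s]]) simp
  qed
  moreover have "(\<Sum>n. c n * herm n x * herm 0 x) = hser c x * herm 0 x" for x
    unfolding hser_def by (rule suminf_mult2[symmetric]) (rule hser_abs_summable[OF assms])
  ultimately have "(\<lambda>n. LINT x|lborel. c n * herm n x * herm 0 x) sums (LINT x|lborel. hser c x * herm 0 x)"
    by simp
  moreover have "(LINT x|lborel. c n * herm n x * herm 0 x) = (if n = 0 then c 0 * hnorm else 0)" for n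
    using integral_herm_orthogonal_0[of "n - 1"]
    by (cases n) (simp_all add: mult.assoc hnorm_def power2_eq_square)
  ultimately have "(\<lambda>n. if n = 0 then c 0 * hnorm else 0) sums (LINT x|lborel. hser c x * herm 0 x)"
    by simp
  moreover have "(\<lambda>n. if n = 0 then c 0 * hnorm else 0) sums (c 0 * hnorm)"
    using sums_single[of 0 "\<lambda>_. c 0 * hnorm"] by simp
  ultimately show ?thesis by (rule sums_unique2)
qed

lemma test_function_support:
  assumes "test_function \<phi>"
  obtains R where "\<And>x. R < \<bar>x\<bar> \<Longrightarrow> \<phi> x = 0"
proof -
  have "bounded {x. \<phi> x \<noteq> 0}"
    using assms bounded_subset[OF compact_imp_bounded closure_subset] by (auto simp: test_function_def)
  then obtain R where "\<And>x. \<phi> x \<noteq> 0 \<Longrightarrow> \<bar>x\<bar> \<le> R"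
    unfolding bounded_iff by auto
  then show thesis using that[of R] by force
qed

lemma integrable_zero_outside:
  fixes f :: "real \<Rightarrow> real"
  assumes "\<And>x. isCont f x" "\<And>x. R < \<bar>x\<bar> \<Longrightarrow> f x = 0"
  shows "integrable lborel f"
proof -
  have "set_integrable lborel {-R..R} f"
    by (intro borel_integrable_atLeastAtMost' continuous_at_imp_continuous_on ballI assms)
  moreover have "(\<lambda>x. indicator {-R..R} x *\<^sub>R f x) = f"
    using assms(2) by (force simp: fun_eq_iff indicator_def)
  ultimately show ?thesis by (simp add: set_integrable_def)
qed

text \<open>Integration by parts without boundary terms, since \<phi> vanishes outside a bounded
  set; the classical derivative of the series is thereby its weak derivative.\<close>

lemma weak_deriv_hser:
  assumes c: "rapid c" and \<phi>: "test_function \<phi>"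
  shows "(LINT x|lborel. hser c x * deriv \<phi> x) = - (LINT x|lborel. hser (dop c) x * \<phi> x)"
proof -
  have fd: "(deriv ^^ n) \<phi> field_differentiable at x" for n x
    using \<phi> by (simp add: test_function_def)
  have D: "(\<phi> has_real_derivative deriv \<phi> x) (at x)" for x
    using fd[of 0] by (simp add: field_differentiable_derivI)
  have C0: "isCont \<phi> x" and C1: "isCont (deriv \<phi>) x" for x
    using fd[of 0] fd[of 1] by (auto intro: field_differentiable_imp_continuous_at)
  obtain R where R: "\<And>x. R < \<bar>x\<bar> \<Longrightarrow> \<phi> x = 0" using test_function_support[OF \<phi>] by metis
  have dR: "deriv \<phi> x = 0" if "R < \<bar>x\<bar>" for x
  proof -
    have "((\<lambda>x. 0) has_real_derivative 0) (at x)" by simp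
    then have "(\<phi> has_real_derivative 0) (at x)"
      by (rule has_field_derivative_transform_within_open[where S = "{x. R < \<bar>x\<bar>}"])
        (use that R in \<open>auto intro!: open_Collect_less continuous_intros\<close>)
    then show ?thesis by (rule DERIV_imp_deriv)
  qed
  have i1: "integrable lborel (\<lambda>x. hser (dop c) x * \<phi> x)"
    by (rule integrable_zero_outside[of _ R]) (auto simp: R intro!: continuous_intros hser_isCont rapid_dop c C0)
  have i2: "integrable lborel (\<lambda>x. hser c x * deriv \<phi> x)"
    by (rule integrable_zero_outside[of _ R]) (auto simp: dR intro!: continuous_intros hser_isCont rapid_dop c C1)
  have i2': "integrable lborel (\<lambda>x. deriv \<phi> x * hser c x)"
    using i2 by (simp add: mult.commute)
  have "(LINT x|lborel. hser (dop c) x * \<phi> x + deriv \<phi> x * hser c x) = 0"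
  proof (rule integral_derivative_eq_0)
    show "((\<lambda>x. hser c x * \<phi> x) has_real_derivative hser (dop c) x * \<phi> x + deriv \<phi> x * hser c x) (at x)" for x
      by (rule DERIV_mult[OF hser_deriv[OF c] D])
    show "isCont (\<lambda>x. hser (dop c) x * \<phi> x + deriv \<phi> x * hser c x) x" for x
      by (intro continuous_intros hser_isCont rapid_dop c C0 C1)
    show "integrable lborel (\<lambda>x. hser (dop c) x * \<phi> x + deriv \<phi> x * hser c x)"
      using i1 i2' by simp
    show "((\<lambda>x. hser c x * \<phi> x) \<longlongrightarrow> 0) at_bot"
      by (rule tendsto_eventually) (auto simp: eventually_at_bot_linorder R intro!: exI[of _ "- \<bar>R\<bar> - 1"])
    show "((\<lambda>x. hser c x * \<phi> x) \<longlongrightarrow> 0) at_top"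
      by (rule tendsto_eventually) (auto simp: eventually_at_top_linorder R intro!: exI[of _ "\<bar>R\<bar> + 1"])
  qed
  then have "(LINT x|lborel. hser (dop c) x * \<phi> x) + (LINT x|lborel. deriv \<phi> x * hser c x) = 0"
    by (simp add: Bochner_Integration.integral_add[OF i1 i2'])
  then show ?thesis by (simp add: mult.commute)
qed

text \<open>Left unnormalised: all \<open>herm n\<close> have the same norm, so dividing by it would
  not change any linear relation between coefficients. Since \<open>herm n\<close> is real, no
  conjugation appears.\<close>

lift_definition hcoeff :: "L2 \<Rightarrow> nat \<Rightarrow> complex" is
  "\<lambda>f n. LINT x|lborel. f x * complex_of_real (herm n x)"
proof
  fix f g n
  assume "L2_rel f g"
  then have fg: "square_integrable f" "square_integrable g" "AE x in lborel. f x = g x"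
    by (auto simp: L2_rel_def)
  note [measurable] = square_integrable_measurable[OF fg(1)] square_integrable_measurable[OF fg(2)]
  show "(LINT x|lborel. f x * complex_of_real (herm n x)) = (LINT x|lborel. g x * complex_of_real (herm n x))"
    by (rule integral_cong_AE) (use fg in auto)
qed

lemma hcoeff_add: "hcoeff (u + v) n = hcoeff u n + hcoeff v n"
  by transfer (simp add: L2_rel_def distrib_right square_integrable_times_herm)

lemma hcoeff_diff: "hcoeff (u - v) n = hcoeff u n - hcoeff v n"
  by transfer (simp add: L2_rel_def left_diff_distrib square_integrable_times_herm)

lemma hcoeff_scaleC: "hcoeff (c *\<^sub>C u) n = c * hcoeff u n"
  by transfer (simp add: mult.assoc)

lemma hcoeff_0 [simp]: "hcoeff 0 n = 0"
  by transfer simp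

lemma hcoeff_eq_0_imp:
  assumes "\<And>n. hcoeff u n = 0"
  shows "u = 0"
  using assms
proof transfer
  fix f
  assume f: "L2_rel f f" "\<And>n. (LINT x|lborel. f x * complex_of_real (herm n x)) = 0"
  then have "AE x in lborel. f x = 0"
    by (intro herm_complete) (auto simp: L2_rel_def)
  then show "L2_rel f (\<lambda>x. 0)"
    using f(1) square_integrable_zero by (simp add: L2_rel_def)
qed

text \<open>The integrand is at most the sum of the squares of both factors, and the square of
  \<open>herm n\<close> has integral \<open>hnorm\<close> for every n. The maximum principle below
  asks for such a bound.\<close>

lemma hcoeff_bounded: "\<exists>B. \<forall>n. cmod (hcoeff u n) \<le> B"
proof transfer
  fix f assume "L2_rel f f"
  then have f: "square_integrable f" by (simp add: L2_rel_def)
  then have if2: "integrable lborel (\<lambda>x. (cmod (f x))\<^sup>2)" by (simp add: square_integrable_def)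
  have ih2: "integrable lborel (\<lambda>x. (herm n x)\<^sup>2)" for n
    using integrable_herm_prod[of n n] by (simp add: power2_eq_square)
  have "cmod (LINT x|lborel. f x * complex_of_real (herm n x)) \<le> (LINT x|lborel. (cmod (f x))\<^sup>2) + hnorm" for n
  proof -
    have "cmod (LINT x|lborel. f x * complex_of_real (herm n x)) \<le> (LINT x|lborel. cmod (f x * complex_of_real (herm n x)))"
      by (rule integral_norm_bound)
    also have "\<dots> \<le> (LINT x|lborel. (cmod (f x))\<^sup>2 + (herm n x)\<^sup>2)"
    proof (rule integral_mono)
      show "integrable lborel (\<lambda>x. cmod (f x * complex_of_real (herm n x)))"
        by (intro integrable_norm square_integrable_times_herm f)
      show "integrable lborel (\<lambda>x. (cmod (f x))\<^sup>2 + (herm n x)\<^sup>2)" using if2 ih2 by simp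
      show "cmod (f x * complex_of_real (herm n x)) \<le> (cmod (f x))\<^sup>2 + (herm n x)\<^sup>2" for x
      proof -
        have "2 * (cmod (f x) * \<bar>herm n x\<bar>) \<le> (cmod (f x))\<^sup>2 + (herm n x)\<^sup>2"
          using sum_squares_bound[of "cmod (f x)" "\<bar>herm n x\<bar>"] by (simp add: mult.assoc)
        moreover have "0 \<le> cmod (f x) * \<bar>herm n x\<bar>" by simp
        ultimately show ?thesis unfolding norm_mult norm_of_real by linarith
      qed
    qed
    also have "\<dots> = (LINT x|lborel. (cmod (f x))\<^sup>2) + hnorm"
      using if2 ih2 by (simp add: integral_herm_sq)
    finally show ?thesis .
  qed
  then show "\<exists>B. \<forall>n. cmod (LINT x|lborel. f x * complex_of_real (herm n x)) \<le> B" by blast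
qed

lemma hcoeff_op_x:
  assumes "(u, v) \<in> op_x"
  shows "hcoeff v = xop (hcoeff u)"
proof
  fix n
  have "is_mult_by_x u v" using assms by (simp add: op_x_def)
  then show "hcoeff v n = xop (hcoeff u) n"
    unfolding xop_def scaleR_conv_of_real
  proof transfer
    fix f g n
    assume "L2_rel f f" "L2_rel g g" and ae: "AE x in lborel. g x = complex_of_real x * f x"
    then have f: "square_integrable f" and g: "square_integrable g" by (auto simp: L2_rel_def)
    note [measurable] = square_integrable_measurable[OF f] square_integrable_measurable[OF g]
    have "(LINT x|lborel. g x * complex_of_real (herm n x)) =
      (LINT x|lborel. complex_of_real (hr n) * (f x * complex_of_real (herm (n - 1) x)) +
        complex_of_real (hr (Suc n)) * (f x * complex_of_real (herm (Suc n) x)))"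
    proof (rule integral_cong_AE)
      show "AE x in lborel. g x * complex_of_real (herm n x) =
        complex_of_real (hr n) * (f x * complex_of_real (herm (n - 1) x)) +
        complex_of_real (hr (Suc n)) * (f x * complex_of_real (herm (Suc n) x))"
        using ae
      proof eventually_elim
        case (elim x)
        then have "g x * complex_of_real (herm n x) = f x * complex_of_real (x * herm n x)"
          by simp
        then show ?case unfolding herm_mult by (simp add: algebra_simps)
      qed
    qed measurable
    then show "(LINT x|lborel. g x * complex_of_real (herm n x)) =
       complex_of_real (hr n) * (LINT x|lborel. f x * complex_of_real (herm (n - 1) x)) +
       complex_of_real (hr (Suc n)) * (LINT x|lborel. f x * complex_of_real (herm (Suc n) x))"
      using square_integrable_times_herm[OF f] by simp
  qed
qed

lemma hcoeff_op_ddx: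
  assumes "(u, v) \<in> op_ddx"
  shows "hcoeff v = dop (hcoeff u)"
proof
  fix n
  have "is_weak_deriv u v" using assms by (simp add: op_ddx_def)
  then show "hcoeff v n = dop (hcoeff u) n"
    unfolding dop_def scaleR_conv_of_real
    by transfer (rule weak_derivative_herm; simp add: L2_rel_def)
qed

section \<open>Elements of the Hilbert space from real coefficient sequences\<close>

definition hL2 :: "(nat \<Rightarrow> real) \<Rightarrow> L2" where
  "hL2 c = abs_L2 (\<lambda>x. complex_of_real (hser c x))"

lemma L2_rel_hser: "rapid c \<Longrightarrow> L2_rel (\<lambda>x. complex_of_real (hser c x)) (\<lambda>x. complex_of_real (hser c x))"
  by (simp add: L2_rel_def hser_square_integrable)

lemma hL2_add: "rapid c \<Longrightarrow> rapid d \<Longrightarrow> hL2 c + hL2 d = hL2 (\<lambda>n. c n + d n)"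
  unfolding hL2_def by (subst plus_L2.abs_eq) (auto simp: L2_rel_hser hser_add)

lemma hL2_scale: "rapid c \<Longrightarrow> complex_of_real r *\<^sub>C hL2 c = hL2 (\<lambda>n. r * c n)"
  unfolding hL2_def by (subst scaleC_L2.abs_eq) (auto simp: L2_rel_hser hser_scale)

lemma hL2_op_x: "rapid c \<Longrightarrow> (hL2 c, hL2 (xop c)) \<in> op_x"
  unfolding hL2_def op_x_def
  by (auto simp: is_mult_by_x.abs_eq L2_rel_hser rapid_xop hser_xop simp flip: of_real_mult)

lemma hL2_op_ddx: "rapid c \<Longrightarrow> (hL2 c, hL2 (dop c)) \<in> op_ddx"
  unfolding hL2_def op_ddx_def
  using weak_deriv_hser[of c]
  by (simp add: is_weak_deriv.abs_eq L2_rel_hser rapid_dop flip: of_real_mult)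

lemma hcoeff_hL2_0: "rapid c \<Longrightarrow> hcoeff (hL2 c) 0 = complex_of_real (c 0 * hnorm)"
  unfolding hL2_def
  by (simp add: hcoeff.abs_eq L2_rel_hser hser_integral_herm_0 flip: of_real_mult)


subsection \<open>The eigenvalue equation for coefficient sequences\<close>

text \<open>The numbers sqrt((n+1)(n+2))/2 and, in \<open>dn\<close>, sqrt(n(n-1))/2: the couplings
  of index n to n + 2 and n - 2 through the dilation generator.\<close>

definition up :: "nat \<Rightarrow> real" where "up n = hr (Suc n) * hr (Suc (Suc n))"
definition dn :: "nat \<Rightarrow> real" where "dn n = hr n * hr (n - 1)"

lemma up_nonneg [simp]: "0 \<le> up n" by (simp add: up_def)
lemma dn_nonneg [simp]: "0 \<le> dn n" by (simp add: dn_def)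
lemma dn_0 [simp]: "dn 0 = 0" "dn (Suc 0) = 0" by (simp_all add: dn_def)

lemma up_pos: "0 < up n" by (simp add: up_def hr_pos)

lemma hr_mult_le: "hr m * hr n \<le> (real m + real n) / 4"
proof -
  have "0 \<le> (hr m - hr n)\<^sup>2" by simp
  then show ?thesis
    by (simp add: power2_eq_square algebra_simps hr_sq)
qed

lemma up_le: "up n \<le> (2 * real n + 3) / 4"
  using hr_mult_le[of "Suc n" "Suc (Suc n)"] by (simp add: up_def)

lemma dn_le: "1 \<le> n \<Longrightarrow> dn n \<le> (2 * real n - 1) / 4"
  using hr_mult_le[of n "n - 1"] by (simp add: dn_def of_nat_diff)

lemma up_0_le: "up 0 \<le> 3/4"
  using up_le[of 0] by simp

text \<open>For n \<ge> 2 the two bounds add up to n + 1/2 \<le> 5n/4. At n = 1 this would fail, but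
  there \<open>dn\<close> vanishes and \<open>up 1\<close> alone is at most 5/4.\<close>

lemma up_dn_le: "1 \<le> n \<Longrightarrow> dn n + up n \<le> 5/4 * real n"
proof (cases "n = 1")
  case True
  have "up 1 \<le> 5/4" using up_le[of 1] by simp
  then show ?thesis using True by simp
next
  case False
  moreover assume "1 \<le> n"
  ultimately show ?thesis using up_le[of n] dn_le[of n] by simp
qed

text \<open>The eigenvalue equation for the coefficients \<open>a\<close>, \<open>b\<close> of the two components; the index
  \<open>n - 2\<close> is truncated only where \<open>dn n = 0\<close>.\<close>

definition ncho_seq :: "real \<Rightarrow> real \<Rightarrow> real \<Rightarrow> (nat \<Rightarrow> 'a::real_normed_vector) \<Rightarrow> (nat \<Rightarrow> 'a) \<Rightarrow> bool" where
  "ncho_seq \<alpha> \<beta> \<mu> a b \<longleftrightarrow> (\<forall>n.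
    (\<alpha> * (real n + 1/2) - \<mu>) *\<^sub>R a n = up n *\<^sub>R b (n + 2) - dn n *\<^sub>R b (n - 2) \<and>
    (\<beta> * (real n + 1/2) - \<mu>) *\<^sub>R b n = dn n *\<^sub>R a (n - 2) - up n *\<^sub>R a (n + 2))"

text \<open>A maximum principle: off the index 0 the diagonal dominates the couplings by the
  factor \<open>8/5\<close>.\<close>

lemma diagonal_dominance_bound:
  fixes y z :: "nat \<Rightarrow> 'a::real_normed_vector"
  assumes bdd: "\<And>n. norm (y n) \<le> B" "\<And>n. norm (z n) \<le> B"
    and zero: "y 0 = 0" "z 0 = 0" and K: "0 \<le> K"
    and y: "\<And>n. 1 \<le> n \<Longrightarrow> 2 * real n * norm (y n) \<le> dn n * norm (z (n - 2)) + up n * norm (z (n + 2)) + real n * K"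
    and z: "\<And>n. 1 \<le> n \<Longrightarrow> 2 * real n * norm (z n) \<le> dn n * norm (y (n - 2)) + up n * norm (y (n + 2)) + real n * K"
  shows "norm (y n) \<le> 4/3 * K" "norm (z n) \<le> 4/3 * K"
proof -
  define A where "A = range (\<lambda>n. norm (y n)) \<union> range (\<lambda>n. norm (z n))"
  \<comment> \<open>The bound B makes this supremum finite, so that it can be estimated by
    itself.\<close>
  define M where "M = Sup A"
  have bA: "bdd_above A" unfolding A_def using bdd by (auto intro!: bdd_aboveI[of _ B])
  have le: "norm (y n) \<le> M" "norm (z n) \<le> M" for n
    unfolding M_def by (rule cSup_upper[OF _ bA]; simp add: A_def)+
  have M0: "0 \<le> M" using le(1)[of 0] by (simp add: zero)
  have step: "t \<le> 5/8 * M + K / 2"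
    if "1 \<le> n" "2 * real n * t \<le> dn n * s + up n * s' + real n * K" "s \<le> M" "s' \<le> M" for n :: nat and t s s'
  proof -
    have "dn n * s + up n * s' \<le> dn n * M + up n * M"
      using that by (intro add_mono mult_left_mono) auto
    also have "\<dots> \<le> (5/4 * real n) * M"
      unfolding distrib_right[symmetric] by (intro mult_right_mono up_dn_le that M0)
    finally have "2 * real n * t \<le> (5/4 * real n) * M + real n * K"
      using that(2) by linarith
    then have "real n * (2 * t) \<le> real n * (5/4 * M + K)" by (simp add: algebra_simps)
    then have "2 * t \<le> 5/4 * M + K"
      using that(1) by simp
    then show ?thesis by simp
  qed
  have "norm (y n) \<le> 5/8 * M + K / 2" for n
    using step[OF _ y le(2) le(2)] M0 K by (cases "n = 0") (auto simp: zero)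
  moreover have "norm (z n) \<le> 5/8 * M + K / 2" for n
    using step[OF _ z le(1) le(1)] M0 K by (cases "n = 0") (auto simp: zero)
  \<comment> \<open>The factor 5/8 is the coupling bound 5/4 divided by the diagonal bound 2;
    solving for M gives the constant 4/3.\<close>
  ultimately have "M \<le> 5/8 * M + K / 2"
    unfolding M_def by (intro cSup_least) (auto simp: A_def M_def)
  then have "M \<le> 4/3 * K" by simp
  then show "norm (y n) \<le> 4/3 * K" "norm (z n) \<le> 4/3 * K"
    using le[of n] by linarith+
qed

lemma diagonal_estimate:
  fixes a b c :: "'a::real_normed_vector"
  assumes "d *\<^sub>R a = b - c" "2 * real n \<le> d"
  shows "2 * real n * norm a \<le> norm b + norm c"
proof -
  have "2 * real n * norm a \<le> \<bar>d\<bar> * norm a"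
    using assms(2) by (intro mult_right_mono) auto
  also have "\<dots> = norm (b - c)" using assms(1) by (metis norm_scaleR)
  also have "\<dots> \<le> norm b + norm c" by (rule norm_triangle_ineq4)
  finally show ?thesis .
qed

text \<open>The zero-point energy \<alpha>/2 pays for \<mu>, and \<alpha> > 2 handles the part
  proportional to n.\<close>

lemma diagonal_ge:
  fixes \<alpha> \<mu> :: real
  assumes "2 < \<alpha>" "\<alpha> \<le> \<gamma>" "\<mu> \<le> \<alpha> / 2"
  shows "2 * real n \<le> \<gamma> * (real n + 1/2) - \<mu>"
proof -
  have "2 * real n + \<alpha> / 2 \<le> \<alpha> * (real n + 1/2)"
    using assms(1) mult_right_mono[of 2 \<alpha> "real n"] by (simp add: algebra_simps)
  also have "\<dots> \<le> \<gamma> * (real n + 1/2)"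
    using assms by (intro mult_right_mono) auto
  finally show ?thesis using assms by linarith
qed

text \<open>The maximum principle with K = 0. By linearity it gives uniqueness of bounded solutions
  with prescribed entries at index 0.\<close>

lemma ncho_seq_eq_0:
  assumes "2 < \<alpha>" "\<alpha> \<le> \<beta>" "\<mu> \<le> \<alpha> / 2"
    and seq: "ncho_seq \<alpha> \<beta> \<mu> a b" and bdd: "\<And>n. norm (a n) \<le> B" "\<And>n. norm (b n) \<le> B"
    and zero: "a 0 = 0" "b 0 = 0"
  shows "a n = 0" "b n = 0"
proof -
  have eqs: "(\<alpha> * (real n + 1/2) - \<mu>) *\<^sub>R a n = up n *\<^sub>R b (n + 2) - dn n *\<^sub>R b (n - 2)"
    "(\<beta> * (real n + 1/2) - \<mu>) *\<^sub>R b n = dn n *\<^sub>R a (n - 2) - up n *\<^sub>R a (n + 2)" for n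
    using seq by (auto simp: ncho_seq_def)
  have a: "2 * real n * norm (a n) \<le> dn n * norm (b (n - 2)) + up n * norm (b (n + 2)) + real n * 0" for n
    using diagonal_estimate[OF eqs(1) diagonal_ge[OF assms(1) order_refl assms(3)], of n] by simp
  have b: "2 * real n * norm (b n) \<le> dn n * norm (a (n - 2)) + up n * norm (a (n + 2)) + real n * 0" for n
    using diagonal_estimate[OF eqs(2) diagonal_ge[OF assms(1-3)], of n] by simp
  show "a n = 0" "b n = 0"
    using diagonal_dominance_bound[OF bdd zero order_refl a b, of n] by simp_all
qed

text \<open>With first entry 1, row 0 of the first block reads \<open>\<mu> = \<alpha>/2 - up 0 * v\<^sub>1\<close>. Eliminating
  \<open>\<mu>\<close> in this way and rescaling \<open>v\<^sub>k = z\<^sub>k / 3\<^sup>k\<close> turns the remaining rows into a fixed point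
  equation for \<open>z\<close>.\<close>

definition iter_den :: "real \<Rightarrow> real \<Rightarrow> real \<Rightarrow> nat \<Rightarrow> real" where
  "iter_den \<alpha> \<beta> t k = (if even k then \<alpha> else \<beta>) * (2 * real k + 1/2) - (\<alpha> / 2 - up 0 * t / 3)"

text \<open>Entry k of the block sits at Hermite index 2k, and the sign alternates because the
  entries alternate between the two components. The factors 1/3 and 3 come from the rescaling: a
  weight r turns the two couplings, each about k, into (r + 1/r) k, to be kept below the diagonal
  4k; r = 3 gives 10k/3.\<close>

definition iter_num :: "(nat \<Rightarrow> real) \<Rightarrow> nat \<Rightarrow> real" where
  "iter_num z k = (-1) ^ k * (up (2 * k) * z (Suc k) / 3 - dn (2 * k) * (3 * z (k - 1)))"

definition iter_map :: "real \<Rightarrow> real \<Rightarrow> (nat \<Rightarrow> real) \<Rightarrow> nat \<Rightarrow> real" where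
  "iter_map \<alpha> \<beta> z k = (if k = 0 then 1 else iter_num z k / iter_den \<alpha> \<beta> (z 1) k)"

text \<open>The diagonal at index 2k contributes 4k; replacing \<mu> by its expression in t costs at
  most a third of \<open>up 0 \<le> 3/4\<close>.\<close>

lemma iter_den_ge:
  assumes "2 < \<alpha>" "\<alpha> \<le> \<beta>" "1 \<le> k" "\<bar>t\<bar> \<le> 1"
  shows "4 * real k - 1/4 \<le> iter_den \<alpha> \<beta> t k"
proof -
  have "2 * real (2 * k) \<le> (if even k then \<alpha> else \<beta>) * (real (2 * k) + 1/2) - \<alpha> / 2"
    using assms(1,2) by (intro diagonal_ge[where \<alpha> = \<alpha>]) auto
  moreover have "- (1/4) \<le> up 0 * t / 3"
  proof -
    have "\<bar>up 0 * t\<bar> \<le> 3/4 * 1"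
      unfolding abs_mult using up_0_le assms(4) by (intro mult_mono) auto
    then show ?thesis by (simp add: abs_le_iff)
  qed
  ultimately show ?thesis by (simp add: iter_den_def)
qed

lemma iter_num_le:
  assumes "1 \<le> k" "\<And>k. \<bar>z k\<bar> \<le> M"
  shows "\<bar>iter_num z k\<bar> \<le> (10/3 * real k - 1/2) * M"
proof -
  have M: "0 \<le> M" using assms(2)[of 0] by simp
  have "\<bar>iter_num z k\<bar> = \<bar>up (2 * k) * z (Suc k) / 3 - dn (2 * k) * (3 * z (k - 1))\<bar>"
    by (simp add: iter_num_def abs_mult)
  also have "\<dots> \<le> up (2 * k) * \<bar>z (Suc k)\<bar> / 3 + dn (2 * k) * (3 * \<bar>z (k - 1)\<bar>)"
    using abs_triangle_ineq4[of "up (2 * k) * z (Suc k) / 3" "dn (2 * k) * (3 * z (k - 1))"]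
    by (simp add: abs_mult)
  also have "\<dots> \<le> (real k + 3/4) * M / 3 + (real k - 1/4) * (3 * M)"
    using up_le[of "2 * k"] dn_le[of "2 * k"] assms M
    by (intro add_mono mult_mono divide_right_mono) auto
  also have "\<dots> = (10/3 * real k - 1/2) * M"
    by (simp add: field_simps)
  finally show ?thesis .
qed

text \<open>The unit ball is preserved since 10k/3 - 1/2 \<le> 4k - 1/4.\<close>

lemma iter_map_le_1:
  assumes "2 < \<alpha>" "\<alpha> \<le> \<beta>" "\<And>k. \<bar>z k\<bar> \<le> 1"
  shows "\<bar>iter_map \<alpha> \<beta> z k\<bar> \<le> 1"
proof (cases "k = 0")
  case False
  then have "1 \<le> k" by simp
  note den = iter_den_ge[OF assms(1,2) this assms(3)[of 1]] and num = iter_num_le[OF this, of z 1, OF assms(3)]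
  have "\<bar>iter_num z k\<bar> \<le> iter_den \<alpha> \<beta> (z 1) k" using den num \<open>1 \<le> k\<close> by simp
  moreover have "0 < iter_den \<alpha> \<beta> (z 1) k" using den \<open>1 \<le> k\<close> by simp
  ultimately show ?thesis using False by (simp add: iter_map_def abs_of_pos)
qed (simp add: iter_map_def)

text \<open>The numerator is linear in z, and the denominator varies by at most D/4 because it
  contains \<open>z 1\<close>. The resulting ratio (10k/3 - 1/4) / (4k - 1/4) stays below 9/10 for
  all k \<ge> 1.\<close>

lemma iter_map_contraction:
  assumes "2 < \<alpha>" "\<alpha> \<le> \<beta>" "\<And>k. \<bar>z k\<bar> \<le> 1" "\<And>k. \<bar>w k\<bar> \<le> 1" "\<And>k. \<bar>z k - w k\<bar> \<le> D"
  shows "\<bar>iter_map \<alpha> \<beta> z k - iter_map \<alpha> \<beta> w k\<bar> \<le> 9/10 * D"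
proof (cases "k = 0")
  case True
  then show ?thesis using assms(5)[of 0] by (simp add: iter_map_def)
next
  case False
  then have k: "1 \<le> k" by simp
  have D: "0 \<le> D" using assms(5)[of 0] by simp
  let ?N = "iter_num z k" and ?N' = "iter_num w k" and ?d = "iter_den \<alpha> \<beta> (z 1) k" and ?d' = "iter_den \<alpha> \<beta> (w 1) k"
  let ?m = "4 * real k - 1/4" and ?n = "10/3 * real k - 1/2"
  have d: "?m \<le> ?d" "?m \<le> ?d'" by (intro iter_den_ge assms k)+
  have m: "15/4 \<le> ?m" using k by simp
  have pos: "0 < ?d" "0 < ?d'" using d m by linarith+
  have "?N - ?N' = iter_num (\<lambda>k. z k - w k) k"
    by (simp add: iter_num_def algebra_simps diff_divide_distrib)
  then have dN: "\<bar>?N - ?N'\<bar> \<le> ?n * D"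
    using iter_num_le[OF k assms(5)] by simp
  have N': "\<bar>?N'\<bar> \<le> ?n" using iter_num_le[OF k assms(4)] by simp
  have dd':
    "\<bar>up 0 * (w 1 - z 1)\<bar> \<le> 3/4 * D"
    unfolding abs_mult using up_0_le assms(5)[of 1] by (intro mult_mono) auto
  have dd: "\<bar>?d' - ?d\<bar> \<le> D / 4"
  proof -
    have "?d' - ?d = up 0 * (w 1 - z 1) / 3" by (simp add: iter_den_def field_simps)
    then have "\<bar>?d' - ?d\<bar> = \<bar>up 0 * (w 1 - z 1) / 3\<bar>" by (rule arg_cong)
    then have "\<bar>?d' - ?d\<bar> = \<bar>up 0 * (w 1 - z 1)\<bar> / 3" by (simp only: abs_divide abs_numeral)
    then show ?thesis using dd' by simp
  qed
  have q: "\<bar>?N' / ?d'\<bar> \<le> 1"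
    using N' d(2) pos(2) k by (simp add: abs_of_pos)
  \<comment> \<open>This form of the difference of two quotients involves the second quotient only
    as a factor of absolute value at most 1.\<close>
  have "?N / ?d - ?N' / ?d' = ((?N - ?N') + (?N' / ?d') * (?d' - ?d)) / ?d"
    using pos by (simp add: field_simps)
  also have "\<bar>\<dots>\<bar> = \<bar>(?N - ?N') + (?N' / ?d') * (?d' - ?d)\<bar> / ?d"
    using pos by (simp add: abs_of_pos)
  also have "\<dots> \<le> (?n * D + 1 * (D / 4)) / ?d"
  proof (rule divide_right_mono)
    have "\<bar>(?N' / ?d') * (?d' - ?d)\<bar> \<le> 1 * (D / 4)"
      unfolding abs_mult by (rule mult_mono[OF q dd]) auto
    then show "\<bar>(?N - ?N') + (?N' / ?d') * (?d' - ?d)\<bar> \<le> ?n * D + 1 * (D / 4)"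
      using dN abs_triangle_ineq[of "?N - ?N'" "(?N' / ?d') * (?d' - ?d)"] by linarith
  qed (use pos in simp)
  also have "\<dots> \<le> 9/10 * D"
  proof -
    have "?n * D + 1 * (D / 4) = (?n + 1/4) * D" by (simp add: algebra_simps)
    also have "\<dots> \<le> (9/10 * ?m) * D" using k D by (intro mult_right_mono) auto
    also have "\<dots> \<le> (9/10 * ?d) * D" using d D by (intro mult_right_mono) auto
    finally show ?thesis using pos by (simp add: pos_divide_le_eq algebra_simps)
  qed
  finally show ?thesis using False by (simp add: iter_map_def)
qed

text \<open>Picard iteration from the zero sequence in the supremum norm. The telescoping series of
  increments is dominated by a geometric series, hence converges uniformly in k, and the contraction
  estimate lets the map pass to the limit.\<close>

lemma iter_fixed_point:
  assumes "2 < \<alpha>" "\<alpha> \<le> \<beta>"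
  obtains z where "\<And>k. \<bar>z k\<bar> \<le> 1" "\<And>k. iter_map \<alpha> \<beta> z k = z k"
proof -
  define f where "f j = (iter_map \<alpha> \<beta> ^^ j) (\<lambda>_. 0)" for j
  have f_Suc: "f (Suc j) = iter_map \<alpha> \<beta> (f j)" for j by (simp add: f_def)
  have f_le: "\<bar>f j k\<bar> \<le> 1" for j k
    by (induction j arbitrary: k) (simp add: f_def, simp add: f_Suc iter_map_le_1[OF assms])
  have step: "\<bar>f (Suc j) k - f j k\<bar> \<le> (9/10) ^ j" for j k
  proof (induction j arbitrary: k)
    case 0
    then show ?case using f_le[of 1] by (simp add: f_def)
  next
    case (Suc j)
    have "\<bar>iter_map \<alpha> \<beta> (f (Suc j)) k - iter_map \<alpha> \<beta> (f j) k\<bar> \<le> 9/10 * (9/10) ^ j"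
      by (rule iter_map_contraction[OF assms f_le f_le Suc])
    then show ?case by (simp add: f_Suc)
  qed
  have "uniformly_convergent_on UNIV (\<lambda>n k. \<Sum>j<n. f (Suc j) k - f j k)"
    by (rule Weierstrass_m_test'[where M = "\<lambda>j. (9/10) ^ j"]) (use step in auto)
  moreover have "(\<Sum>j<n. f (Suc j) k - f j k) = f n k" for n k
    by (subst sum_lessThan_telescope) (simp add: f_def)
  ultimately obtain z where z: "uniform_limit UNIV f z sequentially"
    unfolding uniformly_convergent_on_def by auto
  have z_lim: "(\<lambda>j. f j k) \<longlonglongrightarrow> z k" for k
    using tendsto_uniform_limitI[OF z] by simp
  have z_le: "\<bar>z k\<bar> \<le> 1" for k
    by (rule Lim_bounded[OF tendsto_rabs[OF z_lim]]) (use f_le in auto)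
  have "iter_map \<alpha> \<beta> z k = z k" for k
  proof (rule LIMSEQ_unique)
    show "(\<lambda>j. f (Suc j) k) \<longlonglongrightarrow> z k" using LIMSEQ_Suc[OF z_lim] .
    show "(\<lambda>j. f (Suc j) k) \<longlonglongrightarrow> iter_map \<alpha> \<beta> z k"
    proof (rule LIMSEQ_I)
      fix e :: real assume e: "0 < e"
      then obtain N where N: "\<And>j k. N \<le> j \<Longrightarrow> \<bar>f j k - z k\<bar> < e"
        using uniform_limitD[OF z e] by (auto simp: eventually_sequentially dist_real_def)
      have "\<bar>iter_map \<alpha> \<beta> (f j) k - iter_map \<alpha> \<beta> z k\<bar> \<le> 9/10 * e" if "N \<le> j" for j
        by (rule iter_map_contraction[OF assms f_le z_le]) (use N[OF that] in \<open>auto intro: less_imp_le\<close>)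
      then show "\<exists>N. \<forall>j\<ge>N. norm (f (Suc j) k - iter_map \<alpha> \<beta> z k) < e"
        using e by (intro exI[of _ N]) (force simp: f_Suc)
    qed
  qed
  with z_le show thesis using that by blast
qed

text \<open>The unknown \<mu> is recovered from row 0, the remaining rows are the fixed point
  equation, and undoing the weight gives decay by 1/3 along the block.\<close>

lemma ncho_seq_solution:
  assumes "2 < \<alpha>" "\<alpha> \<le> \<beta>"
  obtains p q :: "nat \<Rightarrow> real" and \<mu> :: real
  where "\<mu> < \<alpha> / 2" "ncho_seq \<alpha> \<beta> \<mu> p q" "p 0 = 1" "q 0 = 0"
    and "\<And>n. odd n \<Longrightarrow> p n = 0" "\<And>n. odd n \<Longrightarrow> q n = 0"
    and "\<And>n. \<bar>p n\<bar> \<le> (3/5) ^ n" "\<And>n. \<bar>q n\<bar> \<le> (3/5) ^ n"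
    and "\<And>n. 1 \<le> n \<Longrightarrow> \<bar>p n\<bar> \<le> 1/3" "\<And>n. 1 \<le> n \<Longrightarrow> \<bar>q n\<bar> \<le> 1/3"
proof -
  obtain z where z: "\<And>k. \<bar>z k\<bar> \<le> 1" "\<And>k. iter_map \<alpha> \<beta> z k = z k"
    using iter_fixed_point[OF assms] by metis
  define \<mu> where "\<mu> = \<alpha> / 2 - up 0 * z 1 / 3"
  define v where "v k = z k / 3 ^ k" for k
  have z0: "z 0 = 1" using z(2)[of 0] by (simp add: iter_map_def)
  have den: "0 < iter_den \<alpha> \<beta> (z 1) k" if "1 \<le> k" for k
    using iter_den_ge[OF assms that z(1)[of 1]] that by simp
  have zk: "iter_den \<alpha> \<beta> (z 1) k * z k = iter_num z k" if "1 \<le> k" for k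
    using z(2)[of k] den[OF that] that by (simp add: iter_map_def field_simps)
  have v_eq: "((if even k then \<alpha> else \<beta>) * (2 * real k + 1/2) - \<mu>) * v k =
      (-1) ^ k * (up (2 * k) * v (Suc k) - dn (2 * k) * v (k - 1))" for k
  proof (cases k)
    case 0
    then show ?thesis by (simp add: v_def \<mu>_def z0)
  next
    case (Suc l)
    have "((if even k then \<alpha> else \<beta>) * (2 * real k + 1/2) - \<mu>) * v k = iter_den \<alpha> \<beta> (z 1) k * z k / 3 ^ k"
      by (simp add: iter_den_def v_def \<mu>_def)
    also have "\<dots> = iter_num z k / 3 ^ k" using zk[of k] Suc by simp
    also have "\<dots> = (-1) ^ k * (up (2 * k) * v (Suc k) - dn (2 * k) * v (k - 1))"
      by (simp add: iter_num_def v_def Suc field_simps)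
    finally show ?thesis .
  qed
  have v_le: "\<bar>v k\<bar> \<le> (1/3) ^ k" for k
    using z(1)[of k] by (simp add: v_def power_one_over divide_le_cancel)
  \<comment> \<open>The sign that puts \<mu> strictly below \<alpha>/2: the numerator in row 1 is at
    least 3/2 - 7/12, as \<open>z 0 = 1\<close> and |z 2| \<le> 1.\<close>
  have "0 < z 1"
  proof -
    have "hr 2 = 1" by (simp add: hr_def)
    moreover have "1/2 \<le> hr 1" unfolding hr_def by (rule real_le_rsqrt) (simp add: power2_eq_square)
    ultimately have "1/2 \<le> dn 2" by (simp add: dn_def)
    moreover have "up 2 * z 2 \<le> 7/4 * 1"
      using up_le[of 2] z(1)[of 2] by (intro order_trans[OF mult_left_mono mult_right_mono]) (auto simp: abs_le_iff)
    moreover have "iter_num z 1 = 3 * dn 2 - up 2 * z 2 / 3"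
      by (simp add: iter_num_def z0 numeral_2_eq_2)
    ultimately have "0 < iter_num z 1" by linarith
    then have "0 < iter_den \<alpha> \<beta> (z 1) 1 * z 1" using zk[of 1] by simp
    then show ?thesis by (rule zero_less_mult_pos) (rule den, simp)
  qed
  \<comment> \<open>Entry k goes to index n = 2k, in the first component for even k and in the
    second for odd k.\<close>
  define p where "p n = (if n mod 4 = 0 then v (n div 2) else 0)" for n
  define q where "q n = (if n mod 4 = 2 then v (n div 2) else 0)" for n
  have dvd: "even n" if "n mod 4 = 0 \<or> n mod 4 = 2" for n :: nat
    using that by presburger
  have bound: "\<bar>p n\<bar> \<le> (1/3) ^ (n div 2)" "\<bar>q n\<bar> \<le> (1/3) ^ (n div 2)" for n
    using v_le[of "n div 2"] by (auto simp: p_def q_def)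
  have odd: "p n = 0" "q n = 0" if "odd n" for n
    using that dvd[of n] by (auto simp: p_def q_def)
  \<comment> \<open>Decay by 1/3 per block entry is decay by 1/sqrt 3 per index, and 3/5 is a
    rational number slightly above that: 9/25 > 1/3.\<close>
  have pow: "(1/3) ^ (n div 2) \<le> (3/5 :: real) ^ n" if "even n" for n
  proof -
    have "(3/5 :: real) ^ n = ((3/5) ^ 2) ^ (n div 2)"
      using that by (simp flip: power_mult)
    then show ?thesis by (simp add: power_mono power2_eq_square)
  qed
  show thesis
  proof (rule that[of \<mu> p q])
    show "\<mu> < \<alpha> / 2" using \<open>0 < z 1\<close> up_pos[of 0] by (simp add: \<mu>_def)
    show "p 0 = 1" "q 0 = 0" by (simp_all add: p_def q_def v_def z0)
    show "p n = 0" "q n = 0" if "odd n" for n using odd that by auto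
    show "\<bar>p n\<bar> \<le> (3/5) ^ n" "\<bar>q n\<bar> \<le> (3/5) ^ n" for n
      using order_trans[OF bound(1) pow, of n] order_trans[OF bound(2) pow, of n] odd[of n]
      by (cases "even n"; simp)+
    have third: "(1/3) ^ (n div 2) \<le> (1/3 :: real)" if "1 \<le> n" "even n" for n
    proof -
      have "n div 2 \<noteq> 0" using that by auto
      then show ?thesis using power_decreasing[of 1 "n div 2" "1/3 :: real"] by simp
    qed
    show "\<bar>p n\<bar> \<le> 1/3" "\<bar>q n\<bar> \<le> 1/3" if "1 \<le> n" for n
      using order_trans[OF bound(1) third[OF that]] order_trans[OF bound(2) third[OF that]] odd[of n]
      by (cases "even n"; simp)+
    show "ncho_seq \<alpha> \<beta> \<mu> p q"
      unfolding ncho_seq_def real_scaleR_def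
    proof (intro allI)
      fix n :: nat
      consider (odd) "odd n" | (zero) m where "n = 4 * m" | (two) m where "n = 4 * m + 2"
      proof -
        have "odd n \<or> n = 4 * (n div 4) \<or> n = 4 * (n div 4) + 2" by presburger
        then show ?thesis using odd zero two by blast
      qed
      then show "(\<alpha> * (real n + 1/2) - \<mu>) * p n = up n * q (n + 2) - dn n * q (n - 2) \<and>
        (\<beta> * (real n + 1/2) - \<mu>) * q n = dn n * p (n - 2) - up n * p (n + 2)"
      proof cases
        case odd
        then have "n = 1 \<or> odd (n - 2)" by presburger
        then show ?thesis using odd \<open>\<And>n. odd n \<Longrightarrow> p n = 0\<close> \<open>\<And>n. odd n \<Longrightarrow> q n = 0\<close> by auto
      next
        case (zero m)
        then have n4: "n mod 4 = 0" "(n + 2) mod 4 = 2" "(n + 2) div 2 = Suc (2 * m)" "n div 2 = 2 * m" by presburger+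
        \<comment> \<open>At m = 0 the truncated index would point to the wrong entry; the factor
          \<open>dn 0 = 0\<close> removes it.\<close>
        have low: "dn n * q (n - 2) = dn n * v (2 * m - 1)" "dn n * p (n - 2) = 0"
        proof -
          have "dn n * q (n - 2) = dn n * v (2 * m - 1) \<and> dn n * p (n - 2) = 0"
          proof (cases m)
            case 0
            then show ?thesis using zero by simp
          next
          case (Suc l)
          then have "n - 2 = 4 * l + 2" "2 * m - 1 = (4 * l + 2) div 2" using zero by auto
          moreover have "(4 * l + 2) mod 4 = 2" by presburger
          ultimately show ?thesis by (simp add: p_def q_def)
          qed
          then show "dn n * q (n - 2) = dn n * v (2 * m - 1)" "dn n * p (n - 2) = 0" by blast+
        qed
        have up: "q (n + 2) = v (Suc (2 * m))" "p (n + 2) = 0" "p n = v (2 * m)" "q n = 0"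
          using n4 by (simp_all add: p_def q_def)
        show ?thesis
          unfolding low up using v_eq[of "2 * m"] zero by simp
      next
        case (two m)
        then have "n mod 4 = 2" "(n - 2) mod 4 = 0" "(n + 2) mod 4 = 0"
          "n div 2 = Suc (2 * m)" "(n - 2) div 2 = 2 * m" "(n + 2) div 2 = Suc (Suc (2 * m))"
          by presburger+
        then have blk: "q (n + 2) = 0" "p (n + 2) = v (Suc (Suc (2 * m)))" "p (n - 2) = v (2 * m)"
            "q (n - 2) = 0" "p n = 0" "q n = v (Suc (2 * m))"
          by (simp_all add: p_def q_def)
        show ?thesis
          unfolding blk using v_eq[of "Suc (2 * m)"] two by (simp add: algebra_simps)
      qed
    qed
  qed
qed

text \<open>The blocks \<open>(a\<^sub>0, b\<^sub>2, a\<^sub>4, \<dots>)\<close> and \<open>(b\<^sub>0, a\<^sub>2, b\<^sub>4, \<dots>)\<close> differ only by exchanging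
  \<open>\<alpha>\<close> and \<open>\<beta>\<close>. Normalised to have the same first entry, decaying solutions of the two
  blocks stay close to each other, too close for the second block to have an eigenvalue
  below one of the first.\<close>

lemma ncho_seq_second_block_0:
  fixes a b :: "nat \<Rightarrow> complex" and p q :: "nat \<Rightarrow> real"
  assumes \<alpha>: "2 < \<alpha>" "\<alpha> < \<beta>" and \<mu>: "E \<le> \<mu>" "\<mu> \<le> \<alpha> / 2"
    and pq: "ncho_seq \<alpha> \<beta> \<mu> p q" "p 0 = 1" "q 0 = 0"
    and odd: "\<And>n. odd n \<Longrightarrow> p n = 0" "\<And>n. odd n \<Longrightarrow> q n = 0"
    and third: "\<And>n. 1 \<le> n \<Longrightarrow> \<bar>p n\<bar> \<le> 1/3" "\<And>n. 1 \<le> n \<Longrightarrow> \<bar>q n\<bar> \<le> 1/3"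
    and ab: "ncho_seq \<alpha> \<beta> E a b" and bdd: "\<And>n. norm (a n) \<le> B" "\<And>n. norm (b n) \<le> B"
  shows "b 0 = 0"
proof (rule ccontr)
  assume c: "b 0 \<noteq> 0"
  \<comment> \<open>The second block rewritten in the pattern of the first: components exchanged,
    one sign flipped, first entry scaled to 1. It then solves the equations of the first block with
    \<alpha> and \<beta> exchanged.\<close>
  define a' where "a' n = (if n mod 4 = 0 then b n / b 0 else 0)" for n
  define b' where "b' n = (if n mod 4 = 2 then - a n / b 0 else 0)" for n
  have ab_eq: "(\<alpha> * (real n + 1/2) - E) *\<^sub>R a n = up n *\<^sub>R b (n + 2) - dn n *\<^sub>R b (n - 2)"
    "(\<beta> * (real n + 1/2) - E) *\<^sub>R b n = dn n *\<^sub>R a (n - 2) - up n *\<^sub>R a (n + 2)" for n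
    using ab unfolding ncho_seq_def by blast+
  have ab': "(\<beta> * (real n + 1/2) - E) *\<^sub>R a' n = up n *\<^sub>R b' (n + 2) - dn n *\<^sub>R b' (n - 2)"
    "(\<alpha> * (real n + 1/2) - E) *\<^sub>R b' n = dn n *\<^sub>R a' (n - 2) - up n *\<^sub>R a' (n + 2)" for n
  proof -
    have lower: "dn n = 0 \<or> (n mod 4 = 0 \<longleftrightarrow> (n - 2) mod 4 = 2) \<and> (n mod 4 = 2 \<longleftrightarrow> (n - 2) mod 4 = 0)"
    proof (cases "n < 2")
      case True
      then have "n = 0 \<or> n = Suc 0" by auto
      then show ?thesis by auto
    next
      case False
      then have "(n mod 4 = 0 \<longleftrightarrow> (n - 2) mod 4 = 2) \<and> (n mod 4 = 2 \<longleftrightarrow> (n - 2) mod 4 = 0)"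
        by presburger
      then show ?thesis by blast
    qed
    have upper: "n mod 4 = 0 \<longleftrightarrow> (n + 2) mod 4 = 2" "n mod 4 = 2 \<longleftrightarrow> (n + 2) mod 4 = 0"
      by presburger+
    have "(\<beta> * (real n + 1/2) - E) *\<^sub>R (b n / b 0) = up n *\<^sub>R (- a (n + 2) / b 0) - dn n *\<^sub>R (- a (n - 2) / b 0)"
      using arg_cong[OF ab_eq(2)[of n], of "\<lambda>t. t / b 0"]
      by (simp add: diff_divide_distrib scaleR_conv_of_real)
    then show "(\<beta> * (real n + 1/2) - E) *\<^sub>R a' n = up n *\<^sub>R b' (n + 2) - dn n *\<^sub>R b' (n - 2)"
      using lower upper by (auto simp: a'_def b'_def)
    have "(\<alpha> * (real n + 1/2) - E) *\<^sub>R (- a n / b 0) = dn n *\<^sub>R (b (n - 2) / b 0) - up n *\<^sub>R (b (n + 2) / b 0)"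
      using arg_cong[OF ab_eq(1)[of n], of "\<lambda>t. - t / b 0"]
      by (simp add: diff_divide_distrib scaleR_conv_of_real)
    then show "(\<alpha> * (real n + 1/2) - E) *\<^sub>R b' n = dn n *\<^sub>R a' (n - 2) - up n *\<^sub>R a' (n + 2)"
      using lower upper by (auto simp: a'_def b'_def)
  qed
  have pq_eq: "(\<alpha> * (real n + 1/2) - \<mu>) * p n = up n * q (n + 2) - dn n * q (n - 2)"
    "(\<beta> * (real n + 1/2) - \<mu>) * q n = dn n * p (n - 2) - up n * p (n + 2)" for n
    using pq(1) unfolding ncho_seq_def real_scaleR_def by blast+
  define \<delta> where "\<delta> = \<beta> - \<alpha>"
  define \<epsilon> where "\<epsilon> = \<mu> - E"
  have \<delta>\<epsilon>: "0 < \<delta>" "0 \<le> \<epsilon>" using \<alpha> \<mu> by (auto simp: \<delta>_def \<epsilon>_def)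
  \<comment> \<open>Size of the inhomogeneity in the equations for the difference. Nonzero terms off
    index 0 have even n \<ge> 2, so n + 1/2 \<le> 5n/4 and 1 \<le> n/2, while the entries of p and q
    are at most 1/3.\<close>
  define K where "K = (5/4 * \<delta> + \<epsilon> / 2) / 3"
  have K: "0 \<le> K" using \<delta>\<epsilon> by (simp add: K_def)
  define y where "y n = a' n - complex_of_real (p n)" for n
  define z where "z n = b' n - complex_of_real (q n)" for n
  have y_eq: "(\<beta> * (real n + 1/2) - E) *\<^sub>R y n =
      up n *\<^sub>R z (n + 2) - (dn n *\<^sub>R z (n - 2) + of_real ((\<delta> * (real n + 1/2) + \<epsilon>) * p n))" for n
  proof -
    have "(\<beta> * (real n + 1/2) - E) * p n =
        up n * q (n + 2) - dn n * q (n - 2) + (\<delta> * (real n + 1/2) + \<epsilon>) * p n"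
      unfolding pq_eq(1)[of n, symmetric] \<delta>_def \<epsilon>_def by algebra
    then have "(\<beta> * (real n + 1/2) - E) *\<^sub>R complex_of_real (p n) =
      of_real (up n * q (n + 2) - dn n * q (n - 2) + (\<delta> * (real n + 1/2) + \<epsilon>) * p n)"
      by (metis of_real_mult scaleR_conv_of_real)
    then show ?thesis
      unfolding y_def z_def scaleR_diff_right ab'(1) by (simp add: scaleR_conv_of_real)
  qed
  have z_eq: "(\<alpha> * (real n + 1/2) - E) *\<^sub>R z n =
      dn n *\<^sub>R y (n - 2) - (up n *\<^sub>R y (n + 2) + of_real ((- \<delta> * (real n + 1/2) + \<epsilon>) * q n))" for n
  proof -
    have "(\<alpha> * (real n + 1/2) - E) * q n =
        dn n * p (n - 2) - up n * p (n + 2) + (- \<delta> * (real n + 1/2) + \<epsilon>) * q n"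
      unfolding pq_eq(2)[of n, symmetric] \<delta>_def \<epsilon>_def by algebra
    then have "(\<alpha> * (real n + 1/2) - E) *\<^sub>R complex_of_real (q n) =
      of_real (dn n * p (n - 2) - up n * p (n + 2) + (- \<delta> * (real n + 1/2) + \<epsilon>) * q n)"
      by (metis of_real_mult scaleR_conv_of_real)
    then show ?thesis
      unfolding y_def z_def scaleR_diff_right ab'(2) by (simp add: scaleR_conv_of_real)
  qed
  have rest: "\<bar>(s * \<delta> * (real n + 1/2) + \<epsilon>) * r\<bar> \<le> real n * K"
    if "1 \<le> n" "odd n \<longrightarrow> r = 0" "\<bar>r\<bar> \<le> 1/3" "\<bar>s\<bar> \<le> 1" for n and r s :: real
  proof (cases "odd n")
    case True
    then show ?thesis using that K by simp
  next
    case False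
    then have n: "2 \<le> real n" using that(1) by (cases "n = 1") auto
    have "\<bar>s * \<delta> * (real n + 1/2) + \<epsilon>\<bar> \<le> \<bar>s * \<delta> * (real n + 1/2)\<bar> + \<bar>\<epsilon>\<bar>"
      by (rule abs_triangle_ineq)
    also have "\<dots> = \<bar>s\<bar> * (\<delta> * (real n + 1/2)) + \<epsilon>"
      using \<delta>\<epsilon> by (simp add: abs_mult)
    also have "\<dots> \<le> 1 * (\<delta> * (real n + 1/2)) + \<epsilon>"
      using \<delta>\<epsilon> that(4) by (intro add_right_mono mult_right_mono) auto
    also have "\<dots> \<le> \<delta> * (5/4 * real n) + \<epsilon> * (real n / 2)"
      unfolding mult_1 using n \<delta>\<epsilon> mult_left_mono[of 1 "real n / 2" \<epsilon>] by (intro add_mono mult_left_mono) auto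
    finally have "\<bar>s * \<delta> * (real n + 1/2) + \<epsilon>\<bar> \<le> real n * (3 * K)"
      by (simp add: K_def algebra_simps)
    then have "\<bar>s * \<delta> * (real n + 1/2) + \<epsilon>\<bar> * \<bar>r\<bar> \<le> real n * (3 * K) * (1/3)"
      using that(3) K by (intro mult_mono) auto
    then show ?thesis by (simp add: abs_mult)
  qed
  have small: "\<bar>p n\<bar> \<le> 1" "\<bar>q n\<bar> \<le> 1" for n
    using third[of n] pq(2,3) by (cases "n = 0"; simp)+
  have B: "0 \<le> B" using bdd(1)[of 0] norm_ge_zero order_trans by blast
  have "norm (z 2) \<le> 4/3 * K"
  proof (rule diagonal_dominance_bound(2)[of y "B / norm (b 0) + 1"])
    have "norm (a' n) \<le> B / norm (b 0)" "norm (b' n) \<le> B / norm (b 0)" for n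
      using bdd[of n] B by (auto simp: a'_def b'_def norm_divide divide_right_mono)
    then show "norm (y n) \<le> B / norm (b 0) + 1" "norm (z n) \<le> B / norm (b 0) + 1" for n
      unfolding y_def z_def using small[of n]
      by (auto intro!: order_trans[OF norm_triangle_ineq4] add_mono)
    show "y 0 = 0" "z 0 = 0" using c pq(2,3) by (simp_all add: y_def z_def a'_def b'_def)
    show "0 \<le> K" by (rule K)
    fix n :: nat assume n: "1 \<le> n"
    have "2 * real n \<le> \<beta> * (real n + 1/2) - E" "2 * real n \<le> \<alpha> * (real n + 1/2) - E"
      using \<alpha> \<mu> by (intro diagonal_ge[where \<alpha> = \<alpha>]; simp)+
    note est = diagonal_estimate[OF y_eq this(1)] diagonal_estimate[OF z_eq this(2)]
    have "norm (dn n *\<^sub>R z (n - 2) + of_real ((\<delta> * (real n + 1/2) + \<epsilon>) * p n)) \<le> dn n * norm (z (n - 2)) + real n * K"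
      using rest[OF n, of "p n" 1] odd(1)[of n] third(1)[OF n]
      by (intro order_trans[OF norm_triangle_ineq] add_mono) (auto simp del: of_real_mult of_real_add)
    then show "2 * real n * norm (y n) \<le> dn n * norm (z (n - 2)) + up n * norm (z (n + 2)) + real n * K"
      using est(1) by simp
    have "norm (up n *\<^sub>R y (n + 2) + of_real ((- \<delta> * (real n + 1/2) + \<epsilon>) * q n)) \<le> up n * norm (y (n + 2)) + real n * K"
      using rest[OF n, of "q n" "-1"] odd(2)[of n] third(2)[OF n]
      by (intro order_trans[OF norm_triangle_ineq] add_mono) (auto simp del: of_real_mult of_real_add)
    then show "2 * real n * norm (z n) \<le> dn n * norm (y (n - 2)) + up n * norm (y (n + 2)) + real n * K"
      using est(2) by simp
  qed
  \<comment> \<open>The maximum principle omits row 0, which now becomes the test: with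
    \<open>y 0 = 0\<close> and \<open>p 0 = 1\<close> it gives this quantity the exact value
    \<delta>/2 + \<epsilon>, above the bound K = 5\<delta>/12 + \<epsilon>/6.\<close>
  then have "up 0 * norm (z 2) \<le> 3/4 * (4/3 * K)"
    using up_0_le by (intro mult_mono) auto
  moreover have "up 0 *\<^sub>R z 2 = of_real (\<delta> / 2 + \<epsilon>)"
    using y_eq[of 0] pq(2) c by (simp add: y_def a'_def numeral_2_eq_2)
  then have "up 0 * norm (z 2) = \<delta> / 2 + \<epsilon>"
    using \<delta>\<epsilon> norm_scaleR[of "up 0" "z 2"] by (simp only: norm_of_real) simp
  ultimately show False
    using \<delta>\<epsilon> by (simp add: K_def)
qed


subsection \<open>Eigenvectors of the oscillator\<close>

lemma hcoeff_harmonic_oscillator: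
  assumes "(u, w) \<in> harmonic_oscillator"
  shows "hcoeff w n = (real n + 1/2) *\<^sub>R hcoeff u n"
proof -
  obtain u1 u2 v1 v2 where "(u, u1) \<in> op_ddx" "(u1, u2) \<in> op_ddx" "(u, v1) \<in> op_x" "(v1, v2) \<in> op_x"
    and w: "w = (- (1/2)) *\<^sub>C u2 + (1/2) *\<^sub>C v2"
    using assms unfolding harmonic_oscillator_def op_add_def op_scale_def by auto
  then have "hcoeff w n = (1/2) *\<^sub>R (xop (xop (hcoeff u)) n - dop (dop (hcoeff u)) n)"
    unfolding w hcoeff_add hcoeff_scaleC
    by (simp add: hcoeff_op_x hcoeff_op_ddx scaleR_conv_of_real algebra_simps)
  also have "\<dots> = (1/2 * (2 * real n + 1)) *\<^sub>R hcoeff u n"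
    unfolding harmonic_seq by simp
  finally show ?thesis by (simp add: field_simps)
qed

lemma hcoeff_dilation_generator:
  assumes "(u, w) \<in> dilation_generator"
  shows "hcoeff w n = up n *\<^sub>R hcoeff u (n + 2) - dn n *\<^sub>R hcoeff u (n - 2)"
proof -
  obtain u1 v where "(u, u1) \<in> op_ddx" "(u1, v) \<in> op_x" and w: "w = v + (1/2) *\<^sub>C u"
    using assms unfolding dilation_generator_def op_add_def op_scale_def by auto
  then have "hcoeff w n = xop (dop (hcoeff u)) n + (1/2) *\<^sub>R hcoeff u n"
    by (simp add: hcoeff_add hcoeff_scaleC hcoeff_op_x hcoeff_op_ddx scaleR_conv_of_real)
  then show ?thesis by (simp add: dilation_seq up_def dn_def)
qed

lemma hL2_harmonic_oscillator:
  assumes c: "rapid c"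
  shows "(hL2 c, hL2 (\<lambda>n. (real n + 1/2) * c n)) \<in> harmonic_oscillator"
proof -
  note r = rapid_xop[OF rapid_xop[OF c]] rapid_dop[OF rapid_dop[OF c]]
  have "(hL2 c, hL2 (dop (dop c))) \<in> op_ddx O op_ddx" "(hL2 c, hL2 (xop (xop c))) \<in> op_x O op_x"
    using hL2_op_ddx[OF c] hL2_op_ddx[OF rapid_dop[OF c]] hL2_op_x[OF c] hL2_op_x[OF rapid_xop[OF c]]
    by blast+
  then have mem: "(hL2 c, (- (1/2)) *\<^sub>C hL2 (dop (dop c)) + (1/2) *\<^sub>C hL2 (xop (xop c))) \<in> harmonic_oscillator"
    unfolding harmonic_oscillator_def op_add_def op_scale_def by blast
  have scale: "(- (1/2)) *\<^sub>C hL2 (dop (dop c)) = hL2 (\<lambda>n. (- (1/2)) * dop (dop c) n)"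
    "(1/2) *\<^sub>C hL2 (xop (xop c)) = hL2 (\<lambda>n. (1/2) * xop (xop c) n)"
    using hL2_scale[OF r(2), of "- (1/2)"] hL2_scale[OF r(1), of "1/2"] by simp_all
  have "(- (1/2)) *\<^sub>C hL2 (dop (dop c)) + (1/2) *\<^sub>C hL2 (xop (xop c)) =
      hL2 (\<lambda>n. (- (1/2)) * dop (dop c) n + (1/2) * xop (xop c) n)"
    unfolding scale by (rule hL2_add[OF rapid_scale[OF r(2)] rapid_scale[OF r(1)]])
  also have "(\<lambda>n. (- (1/2)) * dop (dop c) n + (1/2) * xop (xop c) n) = (\<lambda>n. (real n + 1/2) * c n)"
  proof
    fix n
    show "(- (1/2)) * dop (dop c) n + (1/2) * xop (xop c) n = (real n + 1/2) * c n"
      using harmonic_seq[of c n] by (simp add: field_simps)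
  qed
  finally show ?thesis using mem by simp
qed

lemma hL2_dilation_generator:
  assumes c: "rapid c"
  shows "(hL2 c, hL2 (\<lambda>n. up n * c (n + 2) - dn n * c (n - 2))) \<in> dilation_generator"
proof -
  have "(hL2 c, hL2 (xop (dop c)) + (1/2) *\<^sub>C hL2 c) \<in> dilation_generator"
    using hL2_op_ddx[OF c] hL2_op_x[OF rapid_dop[OF c]]
    unfolding dilation_generator_def op_add_def op_scale_def by blast
  also have "hL2 (xop (dop c)) + (1/2) *\<^sub>C hL2 c = hL2 (\<lambda>n. xop (dop c) n + (1/2) * c n)"
    using hL2_add[OF rapid_xop[OF rapid_dop[OF c]] rapid_scale[OF c], of "1/2"] hL2_scale[OF c, of "1/2"]
    by simp
  also have "(\<lambda>n. xop (dop c) n + (1/2) * c n) = (\<lambda>n. up n * c (n + 2) - dn n * c (n - 2))"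
    using dilation_seq[of c] by (simp add: fun_eq_iff up_def dn_def)
  finally show ?thesis .
qed

text \<open>Writing the diagonal through \<open>xop\<close> and \<open>dop\<close> reduces the claim
  to the stability already known.\<close>

lemma rapid_diagonal: "rapid c \<Longrightarrow> rapid (\<lambda>n. (real n + 1/2) * c n)"
proof -
  assume c: "rapid c"
  have "rapid (\<lambda>n. 1/2 * (xop (xop c) n + (-1) * dop (dop c) n))"
    by (intro rapid_scale rapid_add rapid_xop rapid_dop c)
  moreover have "(\<lambda>n. 1/2 * (xop (xop c) n + (-1) * dop (dop c) n)) = (\<lambda>n. (real n + 1/2) * c n)"
    using harmonic_seq[of c] by (simp add: fun_eq_iff field_simps)
  ultimately show ?thesis by simp
qed

lemma rapid_coupling: "rapid c \<Longrightarrow> rapid (\<lambda>n. up n * c (n + 2) - dn n * c (n - 2))"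
proof -
  assume c: "rapid c"
  have "rapid (\<lambda>n. xop (dop c) n + 1/2 * c n)"
    by (intro rapid_scale rapid_add rapid_xop rapid_dop c)
  moreover have "(\<lambda>n. xop (dop c) n + 1/2 * c n) = (\<lambda>n. up n * c (n + 2) - dn n * c (n - 2))"
    using dilation_seq[of c] by (simp add: fun_eq_iff up_def dn_def)
  ultimately show ?thesis by simp
qed

lemma eigenspace_iff: "u \<in> eigenspace T \<mu> \<longleftrightarrow> (u, \<mu> *\<^sub>C u) \<in> T"
proof -
  have "v + (- \<mu>) *\<^sub>C u = 0 \<longleftrightarrow> v = \<mu> *\<^sub>C u" for v
    by (simp add: add_eq_0_iff2)
  then show ?thesis
    by (auto simp: eigenspace_def op_ker_def op_add_def op_scale_def)
qed

lemma ncho_iff: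
  "(u, v) \<in> ncho \<alpha> \<beta> \<longleftrightarrow> (\<exists>w1 w2 d1 d2.
     (u $ 1, w1) \<in> harmonic_oscillator \<and> (u $ 2, w2) \<in> harmonic_oscillator \<and>
     (u $ 1, d1) \<in> dilation_generator \<and> (u $ 2, d2) \<in> dilation_generator \<and>
     v $ 1 = complex_of_real \<alpha> *\<^sub>C w1 - d2 \<and> v $ 2 = complex_of_real \<beta> *\<^sub>C w2 + d1)" (is "_ \<longleftrightarrow> ?R")
proof
  assume "(u, v) \<in> ncho \<alpha> \<beta>"
  then obtain w d :: "L2 ^ 2" where
    "\<forall>j. (u $ j, w $ j) \<in> harmonic_oscillator" "\<forall>j. (u $ j, d $ j) \<in> dilation_generator"
    and v: "v = (\<chi> i. \<Sum>j\<in>UNIV. matA \<alpha> \<beta> $ i $ j *\<^sub>C w $ j) + (\<chi> i. \<Sum>j\<in>UNIV. matJ $ i $ j *\<^sub>C d $ j)"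
    unfolding ncho_def op_add_def op_tensor_def by auto
  moreover have "v $ 1 = complex_of_real \<alpha> *\<^sub>C w $ 1 - d $ 2" "v $ 2 = complex_of_real \<beta> *\<^sub>C w $ 2 + d $ 1"
    unfolding v by (simp_all add: sum_2 matA_def matJ_def scaleC_one)
  ultimately show ?R by blast
next
  assume ?R
  then obtain w1 w2 d1 d2 where *:
     "(u $ 1, w1) \<in> harmonic_oscillator" "(u $ 2, w2) \<in> harmonic_oscillator"
     "(u $ 1, d1) \<in> dilation_generator" "(u $ 2, d2) \<in> dilation_generator"
     "v $ 1 = complex_of_real \<alpha> *\<^sub>C w1 - d2" "v $ 2 = complex_of_real \<beta> *\<^sub>C w2 + d1" by blast
  define w d :: "L2 ^ 2" where "w = vector [w1, w2]" and "d = vector [d1, d2]"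
  have "\<forall>j. (u $ j, w $ j) \<in> harmonic_oscillator" "\<forall>j. (u $ j, d $ j) \<in> dilation_generator"
    using * by (simp_all add: forall_2 w_def d_def)
  moreover have "v = (\<chi> i. \<Sum>j\<in>UNIV. matA \<alpha> \<beta> $ i $ j *\<^sub>C w $ j) + (\<chi> i. \<Sum>j\<in>UNIV. matJ $ i $ j *\<^sub>C d $ j)"
    using * by (simp add: vec_eq_iff forall_2 sum_2 matA_def matJ_def w_def d_def scaleC_one)
  ultimately show "(u, v) \<in> ncho \<alpha> \<beta>"
    unfolding ncho_def op_add_def op_tensor_def by blast
qed

lemma eigenspace_ncho_seq:
  assumes "u \<in> eigenspace (ncho \<alpha> \<beta>) (complex_of_real \<mu>)"
  shows "ncho_seq \<alpha> \<beta> \<mu> (hcoeff (u $ 1)) (hcoeff (u $ 2))"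
proof -
  obtain w1 w2 d1 d2 where *:
     "(u $ 1, w1) \<in> harmonic_oscillator" "(u $ 2, w2) \<in> harmonic_oscillator"
     "(u $ 1, d1) \<in> dilation_generator" "(u $ 2, d2) \<in> dilation_generator"
    and eq: "complex_of_real \<mu> *\<^sub>C u $ 1 = complex_of_real \<alpha> *\<^sub>C w1 - d2"
     "complex_of_real \<mu> *\<^sub>C u $ 2 = complex_of_real \<beta> *\<^sub>C w2 + d1"
    using assms unfolding eigenspace_iff ncho_iff by (auto simp: scaleC_vec_def)
  have "complex_of_real \<mu> * hcoeff (u $ 1) n = complex_of_real \<alpha> * hcoeff w1 n - hcoeff d2 n"
    "complex_of_real \<mu> * hcoeff (u $ 2) n = complex_of_real \<beta> * hcoeff w2 n + hcoeff d1 n" for n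
    using arg_cong[OF eq(1), of "\<lambda>u. hcoeff u n"] arg_cong[OF eq(2), of "\<lambda>u. hcoeff u n"]
    by (simp_all add: hcoeff_add hcoeff_diff hcoeff_scaleC)
  then show ?thesis
    unfolding ncho_seq_def hcoeff_harmonic_oscillator[OF *(1)] hcoeff_harmonic_oscillator[OF *(2)]
      hcoeff_dilation_generator[OF *(3)] hcoeff_dilation_generator[OF *(4)]
    by (simp add: scaleR_conv_of_real algebra_simps)
qed

lemma ncho_seq_eigenvector:
  assumes p: "rapid p" and q: "rapid q" and seq: "ncho_seq \<alpha> \<beta> \<mu> p q"
  shows "vector [hL2 p, hL2 q] \<in> eigenspace (ncho \<alpha> \<beta>) (complex_of_real \<mu>)"
proof -
  let ?w = "\<lambda>c n. (real n + 1/2) * c n" and ?d = "\<lambda>c n. up n * c (n + 2) - dn n * c (n - 2)"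
  \<comment> \<open>The subtraction becomes a multiple by -1 because the rules for Hermite series
    cover sums and real multiples.\<close>
  have seq': "\<mu> * p n = \<alpha> * ?w p n + (-1) * ?d q n" "\<mu> * q n = \<beta> * ?w q n + ?d p n" for n
    using seq by (auto simp: ncho_seq_def algebra_simps)
  have "complex_of_real \<alpha> *\<^sub>C hL2 (?w p) - hL2 (?d q) = hL2 (\<lambda>n. \<alpha> * ?w p n) + complex_of_real (-1) *\<^sub>C hL2 (?d q)"
    by (simp add: hL2_scale rapid_diagonal p complex_vector.scale_minus_left scaleC_one)
  also have "\<dots> = hL2 (\<lambda>n. \<mu> * p n)"
    unfolding seq' by (subst hL2_scale, intro rapid_coupling q) (intro hL2_add rapid_scale rapid_diagonal rapid_coupling p q)
  also have "\<dots> = complex_of_real \<mu> *\<^sub>C hL2 p" by (simp add: hL2_scale p)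
  finally have 1: "complex_of_real \<mu> *\<^sub>C hL2 p = complex_of_real \<alpha> *\<^sub>C hL2 (?w p) - hL2 (?d q)" ..
  have "complex_of_real \<beta> *\<^sub>C hL2 (?w q) + hL2 (?d p) = hL2 (\<lambda>n. \<mu> * q n)"
    unfolding seq' by (subst hL2_scale, intro rapid_diagonal q) (intro hL2_add rapid_scale rapid_diagonal rapid_coupling p q)
  also have "\<dots> = complex_of_real \<mu> *\<^sub>C hL2 q" by (simp add: hL2_scale q)
  finally have 2: "complex_of_real \<mu> *\<^sub>C hL2 q = complex_of_real \<beta> *\<^sub>C hL2 (?w q) + hL2 (?d p)" ..
  show ?thesis
    unfolding eigenspace_iff ncho_iff
    using 1 2 hL2_harmonic_oscillator[OF p] hL2_harmonic_oscillator[OF q]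
      hL2_dilation_generator[OF p] hL2_dilation_generator[OF q]
    by (auto simp: scaleC_vec_def)
qed

lemma hcoeff_bounded_pair:
  obtains B where "\<And>n. norm (hcoeff u n) \<le> B" "\<And>n. norm (hcoeff v n) \<le> B"
proof -
  obtain B1 B2 where "\<And>n. norm (hcoeff u n) \<le> B1" "\<And>n. norm (hcoeff v n) \<le> B2"
    using hcoeff_bounded by metis
  then show thesis
    by (intro that[of "max B1 B2"]) (auto intro: max.coboundedI1 max.coboundedI2)
qed

text \<open>The coefficients of w - c u form a bounded solution that vanishes at index 0, hence
  vanish altogether; completeness makes the vector zero.\<close>

lemma eigenspace_ncho_proportional:
  assumes "2 < \<alpha>" "\<alpha> \<le> \<beta>" "\<mu> \<le> \<alpha> / 2"
    and u: "u \<in> eigenspace (ncho \<alpha> \<beta>) (complex_of_real \<mu>)"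
    and w: "w \<in> eigenspace (ncho \<alpha> \<beta>) (complex_of_real \<mu>)"
    and zero: "hcoeff (w $ 1) 0 = c * hcoeff (u $ 1) 0" "hcoeff (w $ 2) 0 = c * hcoeff (u $ 2) 0"
  shows "w = c *\<^sub>C u"
proof -
  define a where "a = hcoeff (w $ 1 - c *\<^sub>C u $ 1)"
  define b where "b = hcoeff (w $ 2 - c *\<^sub>C u $ 2)"
  have a: "a n = hcoeff (w $ 1) n - c * hcoeff (u $ 1) n" and b: "b n = hcoeff (w $ 2) n - c * hcoeff (u $ 2) n" for n
    by (simp_all add: a_def b_def hcoeff_diff hcoeff_scaleC)
  have seq: "ncho_seq \<alpha> \<beta> \<mu> a b"
    unfolding ncho_seq_def
  proof
    fix n
    have uw: "(\<alpha> * (real n + 1/2) - \<mu>) *\<^sub>R hcoeff (v $ 1) n = up n *\<^sub>R hcoeff (v $ 2) (n + 2) - dn n *\<^sub>R hcoeff (v $ 2) (n - 2)"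
      "(\<beta> * (real n + 1/2) - \<mu>) *\<^sub>R hcoeff (v $ 2) n = dn n *\<^sub>R hcoeff (v $ 1) (n - 2) - up n *\<^sub>R hcoeff (v $ 1) (n + 2)"
      if "v \<in> eigenspace (ncho \<alpha> \<beta>) (complex_of_real \<mu>)" for v
      using eigenspace_ncho_seq[OF that] unfolding ncho_seq_def by blast+
    show "(\<alpha> * (real n + 1/2) - \<mu>) *\<^sub>R a n = up n *\<^sub>R b (n + 2) - dn n *\<^sub>R b (n - 2) \<and>
      (\<beta> * (real n + 1/2) - \<mu>) *\<^sub>R b n = dn n *\<^sub>R a (n - 2) - up n *\<^sub>R a (n + 2)"
      unfolding a b scaleR_diff_right mult_scaleR_right[symmetric] uw[OF u] uw[OF w]
      by (simp add: right_diff_distrib)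
  qed
  obtain B where B: "\<And>n. norm (a n) \<le> B" "\<And>n. norm (b n) \<le> B"
    unfolding a_def b_def using hcoeff_bounded_pair by metis
  have "a 0 = 0" "b 0 = 0" using zero by (simp_all add: a b)
  from ncho_seq_eq_0[OF assms(1-3) seq B this] have "w $ 1 - c *\<^sub>C u $ 1 = 0" "w $ 2 - c *\<^sub>C u $ 2 = 0"
    unfolding a_def b_def by (blast intro: hcoeff_eq_0_imp)+
  then show ?thesis by (simp add: vec_eq_iff forall_2 scaleC_vec_def)
qed

theorem corollary1p3:
  fixes \<alpha> \<beta> E E_upper :: real and \<rho> :: complex
  assumes "\<beta> > \<alpha>" and "\<alpha> > 2"
    and "is_lowest_eigenvalue (ncho \<alpha> \<beta>) E"
    and "\<rho>\<^sup>2 = complex_of_real (sqrt (\<alpha> * \<beta> - 1)) - \<i>" and "Re \<rho> > 0"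
    and "E_upper =
      sqrt (\<alpha> * \<beta>) * sqrt (\<alpha> * \<beta> - 1) /
      (\<alpha> + \<beta> + \<bar>\<alpha> - \<beta>\<bar> * ((\<alpha> * \<beta> - 1) powr (1/4) / sqrt (\<alpha> * \<beta>)) * Re \<rho>)"
    and "1/2 > (\<beta> / 2 - E_upper) powi (-2) * (1 / (\<alpha>\<^sup>2 - 1)) + 1 / (\<alpha>\<^sup>2 - 1)"
  shows "complex_vector.dim (eigenspace (ncho \<alpha> \<beta>) (of_real E)) = 1"
proof -
  let ?V = "eigenspace (ncho \<alpha> \<beta>) (complex_of_real E)"
  obtain p q :: "nat \<Rightarrow> real" and \<mu> :: real where \<mu>: "\<mu> < \<alpha> / 2" "ncho_seq \<alpha> \<beta> \<mu> p q" "p 0 = 1" "q 0 = 0"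
    and odd: "\<And>n. odd n \<Longrightarrow> p n = 0" "\<And>n. odd n \<Longrightarrow> q n = 0"
    and geom: "\<And>n. \<bar>p n\<bar> \<le> (3/5) ^ n" "\<And>n. \<bar>q n\<bar> \<le> (3/5) ^ n"
    and third: "\<And>n. 1 \<le> n \<Longrightarrow> \<bar>p n\<bar> \<le> 1/3" "\<And>n. 1 \<le> n \<Longrightarrow> \<bar>q n\<bar> \<le> 1/3"
    by (rule ncho_seq_solution[OF assms(2) less_imp_le[OF assms(1)]]) (rule that)
  have rapid: "rapid p" "rapid q"
    by (rule rapid_if_geometric[of "3/5" _ 1]; use geom in simp)+
  have "is_eigenvalue (ncho \<alpha> \<beta>) (complex_of_real \<mu>)"
    unfolding is_eigenvalue_def
  proof (rule bexI)
    show "vector [hL2 p, hL2 q] \<in> eigenspace (ncho \<alpha> \<beta>) (complex_of_real \<mu>)"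
      by (rule ncho_seq_eigenvector[OF rapid \<mu>(2)])
    show "(vector [hL2 p, hL2 q] :: L2 ^ 2) \<noteq> 0"
    proof
      assume "(vector [hL2 p, hL2 q] :: L2 ^ 2) = 0"
      then have "hL2 p = 0" by (simp add: vec_eq_iff forall_2)
      then show False using hcoeff_hL2_0[OF rapid(1)] \<mu>(3) hnorm_pos by simp
    qed
  qed
  then have E: "E \<le> \<mu>" and "is_eigenvalue (ncho \<alpha> \<beta>) (complex_of_real E)"
    using assms(3) unfolding is_lowest_eigenvalue_def by auto
  then obtain u where u: "u \<in> ?V" "u \<noteq> 0" unfolding is_eigenvalue_def by blast
  \<comment> \<open>Every eigenvector for E is compared with the one solution p, q; this is where E
    \<le> \<mu> enters with its sign.\<close>
  have b0: "hcoeff (w $ 2) 0 = 0" if "w \<in> ?V" for w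
  proof -
    obtain B where "\<And>n. norm (hcoeff (w $ 1) n) \<le> B" "\<And>n. norm (hcoeff (w $ 2) n) \<le> B"
      using hcoeff_bounded_pair by metis
    from ncho_seq_second_block_0[OF assms(2,1) E _ \<mu>(2-4) odd third eigenspace_ncho_seq[OF that] this] \<mu>(1)
    show ?thesis by simp
  qed
  have multiple: "w = c *\<^sub>C u" if "w \<in> ?V" "hcoeff (w $ 1) 0 = c * hcoeff (u $ 1) 0" for w c
    using that u b0 assms(1,2) E \<mu>(1)
    by (intro eigenspace_ncho_proportional[where \<alpha> = \<alpha> and \<beta> = \<beta> and \<mu> = E]) auto
  \<comment> \<open>If this coefficient were 0, proportionality of u to itself with factor 0 would
    give u = 0.\<close>
  have a0: "hcoeff (u $ 1) 0 \<noteq> 0" using multiple[OF u(1), of 0] u(2) by auto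
  have "?V \<subseteq> complex_vector.span {u}"
  proof
    fix w assume "w \<in> ?V"
    then have "w = (hcoeff (w $ 1) 0 / hcoeff (u $ 1) 0) *\<^sub>C u" using a0 by (intro multiple) auto
    then show "w \<in> complex_vector.span {u}"
      by (metis complex_vector.span_base complex_vector.span_scale singletonI)
  qed
  then show ?thesis
    using u by (intro complex_vector.dim_unique[of "{u}"]) auto
qed

end
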